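(* Let $k$ be a field of characteristic $0$ and let $\varphi\in k\langle\langle X_0,X_1\rangle\rangle$ be a group-like non-commutative formal power series with $c_{X_0}(\varphi)=c_{X_1}(\varphi)=0$. Suppose that $\varphi$ satisfies the generalized double shuffle relation $\Delta_*(\varphi_* )=\varphi_*\widehat\otimes\varphi_*$. Then its meta-abelian quotient $B_\varphi$ is gamma-factorisable, i.e. there exists a unique series $\Gamma_\varphi(s)\in1+s^2k[[s]]$ such that $$B_\varphi(x_0,x_1)=\frac{\Gamma_\varphi(x_0)\Gamma_\varphi(x_1)}{\Gamma_\varphi(x_0+x_1)}.$$ Moreover the gamma element $\Gamma_\varphi$ gives the correction term $\varphi_{\mathrm{corr}}$ of the series shuffle regularization by $\varphi_{\mathrm{corr}}=\Gamma_\varphi(-Y_1)^{-1}$.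
   Context: $k\langle\langle X_0,X_1\rangle\rangle$ is the ring of non-commutative formal power series. A series $\varphi$ is group-like if its constant term is $1$ and $\Delta(\varphi)=\varphi\widehat\otimes\varphi$, where $\Delta$ is the (continuous algebra) coproduct with $\Delta(X_i)=X_i\otimes1+1\otimes X_i$. $c_W(\varphi)$ is the coefficient of the word $W$ in $\varphi$. Meta-abelian quotient: $\varphi$ is uniquely expressed as $\varphi=1+\varphi_{X_0}X_0+\varphi_{X_1}X_1$ with $\varphi_{X_0},\varphi_{X_1}\in k\langle\langle X_0,X_1\rangle\rangle$; put $B_\varphi(x_0,x_1):=(1+\varphi_{X_1}X_1)^{\mathrm{ab}}$, where $h\mapsto h^{\mathrm{ab}}$ is the abelianization map $k\langle\langle X_0,X_1\rangle\rangle\to k[[x_0,x_1]]$, $X_i\mapsto x_i$. Double shuffle: $\pi_Y:k\langle\langle X_0,X_1\rangle\rangle\to k\langle\langle Y_1,Y_2,\dots\rangle\rangle$ is the (continuous) $k$-linear map sending words ending in $X_0$ to $0$ and $X_0^{n_m-1}X_1\cdots X_0^{n_1-1}X_1$ to $(-1)^mY_{n_m}\cdots Y_{n_1}$ (and $1\mapsto1$). $\Delta_*$ is the (continuous algebra) coproduct on $k\langle\langle Y_1,Y_2,\dots\rangle\rangle$ with $\Delta_*(Y_n)=\sum_{i=0}^nY_i\otimes Y_{n-i}$, $Y_0:=1$. The series shuffle regularization is $\varphi_*=\varphi_{\mathrm{corr}}\cdot\pi_Y(\varphi)$ with correction term $$\varphi_{\mathrm{corr}}=\exp\Bigl(\sum_{n=1}^\infty\frac{(-1)^n}{n}c_{X_0^{n-1}X_1}(\varphi)\,Y_1^n\Bigr).$$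 *)

theory Defs
  imports
    "HOL-Computational_Algebra.Formal_Power_Series"
    "HOL-Library.Groups_Big_Fun"
begin

section \<open>Non-commutative formal power series\<close>

text \<open>
  A series over the alphabet \<open>'x\<close> is identified with the family of its coefficients,
  indexed by words; a word is read from left to right.
\<close>

typedef ('x, 'r) ncps = "UNIV :: ('x list \<Rightarrow> 'r) set"
  morphisms nc_coeff Abs_ncps
  by simp

lemma nc_coeff_Abs [simp]: "nc_coeff (Abs_ncps f) = f"
  by (simp add: Abs_ncps_inverse)

lemma ncps_eqI: "(\<And>w. nc_coeff f w = nc_coeff g w) \<Longrightarrow> f = g"
  by (metis ext nc_coeff_inject)

instantiation ncps :: (type, ring_1) ring_1
begin

definition zero_ncps_def: "0 = Abs_ncps (\<lambda>w. 0)"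
definition one_ncps_def: "1 = Abs_ncps (\<lambda>w. if w = [] then 1 else 0)"
definition plus_ncps_def: "f + g = Abs_ncps (\<lambda>w. nc_coeff f w + nc_coeff g w)"
definition minus_ncps_def: "f - g = Abs_ncps (\<lambda>w. nc_coeff f w - nc_coeff g w)"
definition uminus_ncps_def: "- f = Abs_ncps (\<lambda>w. - nc_coeff f w)"
definition times_ncps_def:
  "f * g = Abs_ncps (\<lambda>w. \<Sum>i\<le>length w. nc_coeff f (take i w) * nc_coeff g (drop i w))"

instance
proof
  fix a b c :: "('a, 'b) ncps"
  show "a + b + c = a + (b + c)"
    by (simp add: plus_ncps_def add.assoc)
  show "a + b = b + a"
    by (simp add: plus_ncps_def add.commute)
  show "0 + a = a"
    by (simp add: plus_ncps_def zero_ncps_def nc_coeff_inverse)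
  show "- a + a = 0"
    by (simp add: plus_ncps_def zero_ncps_def uminus_ncps_def)
  show "a - b = a + - b"
    by (simp add: plus_ncps_def minus_ncps_def uminus_ncps_def)
  show "(a + b) * c = a * c + b * c"
    by (simp add: plus_ncps_def times_ncps_def distrib_right sum.distrib)
  show "a * (b + c) = a * b + a * c"
    by (simp add: plus_ncps_def times_ncps_def distrib_left sum.distrib)
  show "(0 :: ('a, 'b) ncps) \<noteq> 1"
  proof
    assume "(0 :: ('a, 'b) ncps) = 1"
    then have "nc_coeff (0 :: ('a, 'b) ncps) [] = nc_coeff (1 :: ('a, 'b) ncps) []"
      by simp
    then show False
      by (simp add: zero_ncps_def one_ncps_def)
  qed
  show "1 * a = a"
  proof (rule ncps_eqI)
    fix w
    have "nc_coeff (1 * a) w = (\<Sum>i\<le>length w. if i = 0 then nc_coeff a w else 0)"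
      unfolding times_ncps_def one_ncps_def nc_coeff_Abs
      by (rule sum.cong) auto
    then show "nc_coeff (1 * a) w = nc_coeff a w"
      by simp
  qed
  show "a * 1 = a"
  proof (rule ncps_eqI)
    fix w
    have "nc_coeff (a * 1) w = (\<Sum>i\<le>length w. if i = length w then nc_coeff a w else 0)"
      unfolding times_ncps_def one_ncps_def nc_coeff_Abs
      by (rule sum.cong) auto
    then show "nc_coeff (a * 1) w = nc_coeff a w"
      by simp
  qed
  show "a * b * c = a * (b * c)"
  proof (rule ncps_eqI)
    fix w
    let ?F = "\<lambda>i j. nc_coeff a (take i w) * nc_coeff b (take j (drop i w)) * nc_coeff c (drop (i + j) w)"
    let ?n = "length w"
    have "nc_coeff (a * b * c) w = (\<Sum>k\<le>?n. \<Sum>i\<le>k. ?F i (k - i))"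
      unfolding times_ncps_def nc_coeff_Abs sum_distrib_right
      by (intro sum.cong refl) (auto simp: min_def drop_take)
    also have "\<dots> = (\<Sum>(i,j)\<in>{(i,j). i + j \<le> ?n}. ?F i j)"
      by (rule sum.triangle_reindex_eq [symmetric])
    also have "{(i,j). i + j \<le> ?n} = Sigma {..?n} (\<lambda>i. {..?n - i})"
      by auto
    also have "(\<Sum>(i,j)\<in>Sigma {..?n} (\<lambda>i. {..?n - i}). ?F i j) = (\<Sum>i\<le>?n. \<Sum>j\<le>?n - i. ?F i j)"
      by (rule sum.Sigma [symmetric]) auto
    also have "\<dots> = nc_coeff (a * (b * c)) w"
      unfolding times_ncps_def nc_coeff_Abs sum_distrib_left
      by (intro sum.cong refl) (auto simp: mult.assoc add.commute)
    finally show "nc_coeff (a * b * c) w = nc_coeff (a * (b * c)) w" .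
  qed
qed

end

definition nc_var :: "'x \<Rightarrow> ('x, 'r::ring_1) ncps" where
  "nc_var a = Abs_ncps (\<lambda>w. if w = [a] then 1 else 0)"

text \<open>The two-sided inverse; it exists for constant term 1 (see \<open>nc_inverse_mult\<close>).\<close>

definition nc_inverse :: "('x, 'r::ring_1) ncps \<Rightarrow> ('x, 'r) ncps" where
  "nc_inverse f = (THE g. f * g = 1 \<and> g * f = 1)"

lemma nc_inverse_eqI:
  assumes "f * g = 1" "g * f = 1"
  shows "nc_inverse f = g"
  unfolding nc_inverse_def
proof (rule the_equality)
  fix h assume "f * h = 1 \<and> h * f = 1"
  then show "h = g"
    using assms by (metis mult.assoc mult_1_left mult_1_right)
qed (use assms in simp)

text \<open>
  Substitution of a series \<open>p\<close> with zero constant term into a one-variable series \<open>g\<close>,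
  i.e. \<open>g(p) = \<Sum>n. g\<^sub>n p\<^sup>n\<close>. \<^const>\<open>Sum_any\<close> is the sum over all indices of a
  family with finite support; each coefficient of \<open>g(p)\<close> is such a sum
  (see \<open>finite_support_nc_subst\<close>).
\<close>

definition nc_subst :: "'r::ring_1 fps \<Rightarrow> ('x, 'r) ncps \<Rightarrow> ('x, 'r) ncps" where
  "nc_subst g p = Abs_ncps (\<lambda>w. Sum_any (\<lambda>n. fps_nth g n * nc_coeff (p ^ n) w))"

section \<open>Completed tensor square and coproducts\<close>

text \<open>
  The completed tensor product of \<open>R\<langle>\<langle>A\<rangle>\<rangle>\<close> and \<open>R\<langle>\<langle>B\<rangle>\<rangle>\<close> is
  the algebra of families \<open>t\<^bsub>u,v\<^esub>\<close> of coefficients of \<open>u \<otimes> v\<close>, where the two factors commute.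
  It is encoded as \<open>(R\<langle>\<langle>B\<rangle>\<rangle>)\<langle>\<langle>A\<rangle>\<rangle>\<close>, so that its multiplication is
  \<open>(u \<otimes> v)(u' \<otimes> v') = uu' \<otimes> vv'\<close>.
\<close>

type_synonym ('x, 'r) nc_tensor2 = "('x, ('x, 'r) ncps) ncps"

definition nc_coeff2 :: "('x, 'r) nc_tensor2 \<Rightarrow> 'x list \<Rightarrow> 'x list \<Rightarrow> 'r" where
  "nc_coeff2 t u v = nc_coeff (nc_coeff t u) v"

definition nc_tensor :: "('x, 'r::comm_ring_1) ncps \<Rightarrow> ('x, 'r) ncps \<Rightarrow> ('x, 'r) nc_tensor2"
  (infixr \<open>\<otimes>\<^bsub>nc\<^esub>\<close> 75) where
  "f \<otimes>\<^bsub>nc\<^esub> g = Abs_ncps (\<lambda>u. Abs_ncps (\<lambda>v. nc_coeff f u * nc_coeff g v))"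

text \<open>
  The continuous algebra homomorphism from the series ring to its tensor square
  with prescribed values \<open>D a\<close> on the letters:
  a word \<open>a\<^sub>1 \<dots> a\<^sub>r\<close> is sent to \<open>D a\<^sub>1 \<dots> D a\<^sub>r\<close>, and this is extended to infinite
  linear combinations of words coefficientwise. For the two coproducts below
  only finitely many words contribute to each coefficient
  (see \<open>finite_support_coprod_X\<close> and \<open>finite_support_coprod_Y\<close>).
\<close>

definition nc_coprod ::
    "('x \<Rightarrow> ('x, 'r::comm_ring_1) nc_tensor2) \<Rightarrow> ('x, 'r) ncps \<Rightarrow> ('x, 'r) nc_tensor2" where
  "nc_coprod D f = Abs_ncps (\<lambda>u. Abs_ncps (\<lambda>v.
     Sum_any (\<lambda>w. nc_coeff f w * nc_coeff2 (prod_list (map D w)) u v)))"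

datatype xletter = X\<^sub>0 | X\<^sub>1

definition coprod_X :: "(xletter, 'k::comm_ring_1) ncps \<Rightarrow> (xletter, 'k) nc_tensor2" where
  "coprod_X = nc_coprod (\<lambda>a. nc_var a \<otimes>\<^bsub>nc\<^esub> 1 + 1 \<otimes>\<^bsub>nc\<^esub> nc_var a)"

definition group_like :: "(xletter, 'k::comm_ring_1) ncps \<Rightarrow> bool" where
  "group_like \<phi> \<longleftrightarrow> nc_coeff \<phi> [] = 1 \<and> coprod_X \<phi> = \<phi> \<otimes>\<^bsub>nc\<^esub> \<phi>"

text \<open>
  The alphabet \<open>Y\<^sub>1, Y\<^sub>2, \<dots>\<close>: the letter \<open>YLetter i\<close> stands for \<open>Y\<^bsub>i+1\<^esub>\<close>.
\<close>

datatype yletter = YLetter nat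

fun yindex :: "yletter \<Rightarrow> nat" where
  "yindex (YLetter i) = Suc i"

definition Y :: "nat \<Rightarrow> (yletter, 'k::ring_1) ncps" where
  "Y n = (if n = 0 then 1 else nc_var (YLetter (n - 1)))"

definition coprod_Y :: "(yletter, 'k::comm_ring_1) ncps \<Rightarrow> (yletter, 'k) nc_tensor2" where
  "coprod_Y = nc_coprod (\<lambda>a. \<Sum>i\<le>yindex a. Y i \<otimes>\<^bsub>nc\<^esub> Y (yindex a - i))"

section \<open>Series shuffle regularization\<close>

text \<open>
  The word \<open>X\<^sub>0\<^bsup>n\<^sub>m-1\<^esup>X\<^sub>1 \<cdots> X\<^sub>0\<^bsup>n\<^sub>1-1\<^esup>X\<^sub>1\<close> belonging to \<open>Y\<^bsub>n\<^sub>m\<^esub> \<cdots> Y\<^bsub>n\<^sub>1\<^esub>\<close>.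
  This is a bijection from the words in the \<open>Y\<^sub>n\<close> onto the words in \<open>X\<^sub>0, X\<^sub>1\<close> that do
  not end in \<open>X\<^sub>0\<close>.
\<close>

definition xword :: "yletter list \<Rightarrow> xletter list" where
  "xword v = concat (map (\<lambda>a. replicate (yindex a - 1) X\<^sub>0 @ [X\<^sub>1]) v)"

text \<open>
  Hence the coefficient of \<open>\<pi>\<^sub>Y(\<phi>)\<close> at a word \<open>v\<close> of length \<open>m\<close> is \<open>(-1)\<^sup>m\<close> times the
  coefficient of \<open>\<phi>\<close> at the only word mapped by \<open>\<pi>\<^sub>Y\<close> to a multiple of \<open>v\<close>.
\<close>

definition pi_Y :: "(xletter, 'k::ring_1) ncps \<Rightarrow> (yletter, 'k) ncps" where
  "pi_Y \<phi> = Abs_ncps (\<lambda>v. (-1) ^ length v * nc_coeff \<phi> (xword v))"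

definition corr_term :: "(xletter, 'k::field_char_0) ncps \<Rightarrow> (yletter, 'k) ncps" where
  "corr_term \<phi> = nc_subst (fps_exp 1)
     (nc_subst (Abs_fps (\<lambda>n. if n = 0 then 0 else
        (-1) ^ n / of_nat n * nc_coeff \<phi> (replicate (n - 1) X\<^sub>0 @ [X\<^sub>1]))) (Y 1))"

definition series_reg :: "(xletter, 'k::field_char_0) ncps \<Rightarrow> (yletter, 'k) ncps" where
  "series_reg \<phi> = corr_term \<phi> * pi_Y \<phi>"

section \<open>Meta-abelian quotient\<close>

text \<open>
  \<open>k[[x\<^sub>0, x\<^sub>1]]\<close> is encoded as \<open>(k[[x\<^sub>0]])[[x\<^sub>1]]\<close>: the coefficient of \<open>x\<^sub>0\<^sup>i x\<^sub>1\<^sup>j\<close>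
  in \<open>f\<close> is \<open>f $ j $ i\<close>.
\<close>

definition x0 :: "'k::comm_ring_1 fps fps" where
  "x0 = fps_const fps_X"

definition x1 :: "'k::comm_ring_1 fps fps" where
  "x1 = fps_X"

text \<open>
  As for \<open>nc_subst\<close>, for \<open>p\<close> with zero constant term
  (see \<open>finite_support_fps2_subst\<close>). Composition \<open>oo\<close> of one-variable series does not apply,
  because \<open>x\<^sub>0 + x\<^sub>1\<close> has constant term \<open>x\<^sub>0 \<noteq> 0\<close> as a series in \<open>x\<^sub>1\<close>.
\<close>

definition fps2_subst :: "'k::comm_ring_1 fps \<Rightarrow> 'k fps fps \<Rightarrow> 'k fps fps" where
  "fps2_subst g p = Abs_fps (\<lambda>j. Abs_fps (\<lambda>i.
     Sum_any (\<lambda>n. fps_nth g n * fps_nth (fps_nth (p ^ n) j) i)))"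

text \<open>
  Finitely many words contribute to each coefficient, see \<open>finite_support_abelianize\<close>.
\<close>

definition abelianize :: "(xletter, 'k::comm_ring_1) ncps \<Rightarrow> 'k fps fps" where
  "abelianize h = Abs_fps (\<lambda>j. Abs_fps (\<lambda>i. Sum_any (\<lambda>w. nc_coeff h w *
     fps_nth (fps_nth (prod_list (map (\<lambda>a. case a of X\<^sub>0 \<Rightarrow> x0 | X\<^sub>1 \<Rightarrow> x1) w)) j) i)))"

text \<open>
  \<open>right_part a \<phi>\<close> is the series \<open>\<phi>\<^sub>a\<close> of the unique expression
  \<open>\<phi> = c + \<phi>\<^bsub>X\<^sub>0\<^esub> X\<^sub>0 + \<phi>\<^bsub>X\<^sub>1\<^esub> X\<^sub>1\<close>, with \<open>c\<close> the constant term
  (see \<open>right_part_decomposition\<close> and \<open>right_part_unique\<close>).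
\<close>

definition right_part :: "xletter \<Rightarrow> (xletter, 'k) ncps \<Rightarrow> (xletter, 'k) ncps" where
  "right_part a \<phi> = Abs_ncps (\<lambda>w. nc_coeff \<phi> (w @ [a]))"

definition meta_abelian_quotient :: "(xletter, 'k::comm_ring_1) ncps \<Rightarrow> 'k fps fps" where
  "meta_abelian_quotient \<phi> = abelianize (1 + right_part X\<^sub>1 \<phi> * nc_var X\<^sub>1)"

text \<open>
  The gamma elements of a two-variable series \<open>B\<close>. The denominator is invertible
  (see \<open>fps2_divide_mult\<close> and \<open>fps2_subst_const\<close>), so the quotient is the genuine one.
\<close>

definition is_gamma_element :: "'k::field_char_0 fps \<Rightarrow> 'k fps fps \<Rightarrow> bool" where
  "is_gamma_element \<Gamma> B \<longleftrightarrow>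
     \<Gamma> \<in> {1 + fps_X ^ 2 * g | g. True} \<and>
     B = fps2_subst \<Gamma> x0 * fps2_subst \<Gamma> x1 / fps2_subst \<Gamma> (x0 + x1)"

definition gamma_factorisable :: "'k::field_char_0 fps fps \<Rightarrow> bool" where
  "gamma_factorisable B \<longleftrightarrow> (\<exists>!\<Gamma>. is_gamma_element \<Gamma> B)"

section \<open>Well-definedness\<close>

lemma nc_coeff_simps [simp]:
  "nc_coeff 0 w = 0"
  "nc_coeff 1 w = (if w = [] then 1 else 0)"
  "nc_coeff (f + g) w = nc_coeff f w + nc_coeff g w"
  "nc_coeff (f - g) w = nc_coeff f w - nc_coeff g w"
  "nc_coeff (- f) w = - nc_coeff f w"
  by (simp_all add: zero_ncps_def one_ncps_def plus_ncps_def minus_ncps_def uminus_ncps_def)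

lemma nc_coeff_times:
  "nc_coeff (f * g) w = (\<Sum>i\<le>length w. nc_coeff f (take i w) * nc_coeff g (drop i w))"
  by (simp add: times_ncps_def)

lemma nc_coeff_sum: "nc_coeff (sum f A) w = (\<Sum>a\<in>A. nc_coeff (f a) w)"
  by (induction A rule: infinite_finite_induct) simp_all

lemma nc_coeff_power_eq_0:
  assumes "nc_coeff p [] = 0" "length w < n"
  shows "nc_coeff (p ^ n) w = 0"
  using assms(2)
proof (induction n arbitrary: w)
  case (Suc n)
  have "nc_coeff p (take i w) * nc_coeff (p ^ n) (drop i w) = 0" if "i \<le> length w" for i
  proof (cases "i = 0")
    case False
    then have "length (drop i w) < n" using that Suc.prems by simp
    then show ?thesis using Suc.IH by (metis mult_zero_right)
  qed (simp add: assms(1))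
  then show ?case by (simp add: nc_coeff_times)
qed simp

lemma finite_support_nc_subst:
  assumes "nc_coeff p [] = 0"
  shows "finite {n. fps_nth g n * nc_coeff (p ^ n) w \<noteq> 0}"
proof (rule finite_subset)
  show "{n. fps_nth g n * nc_coeff (p ^ n) w \<noteq> 0} \<subseteq> {..length w}"
    using nc_coeff_power_eq_0 [OF assms] by (force simp: not_less [symmetric])
qed simp

lemma nc_coeff2_simps:
  "nc_coeff2 0 u v = 0"
  "nc_coeff2 1 u v = (if u = [] \<and> v = [] then 1 else 0)"
  "nc_coeff2 (s + t) u v = nc_coeff2 s u v + nc_coeff2 t u v"
  "nc_coeff2 (f \<otimes>\<^bsub>nc\<^esub> g) u v = nc_coeff f u * nc_coeff g v"
  by (simp_all add: nc_coeff2_def nc_tensor_def)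

lemma nc_coeff2_sum: "nc_coeff2 (sum f A) u v = (\<Sum>a\<in>A. nc_coeff2 (f a) u v)"
  by (simp add: nc_coeff2_def nc_coeff_sum)

lemma nc_coeff2_times:
  "nc_coeff2 (s * t) u v = (\<Sum>i\<le>length u. \<Sum>j\<le>length v.
     nc_coeff2 s (take i u) (take j v) * nc_coeff2 t (drop i u) (drop j v))"
  by (simp add: nc_coeff2_def nc_coeff_times nc_coeff_sum)

lemma nc_tensor_times:
  "(f \<otimes>\<^bsub>nc\<^esub> g) * (f' \<otimes>\<^bsub>nc\<^esub> g') = (f * f') \<otimes>\<^bsub>nc\<^esub> (g * g')"
proof -
  have "nc_coeff2 ((f \<otimes>\<^bsub>nc\<^esub> g) * (f' \<otimes>\<^bsub>nc\<^esub> g')) u v = nc_coeff2 ((f * f') \<otimes>\<^bsub>nc\<^esub> (g * g')) u v" for u v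
    by (simp add: nc_coeff2_times nc_coeff2_simps nc_coeff_times sum_product mult_ac)
  then show ?thesis
    unfolding nc_coeff2_def by (intro ncps_eqI)
qed

lemma finite_support_nc_coprod:
  fixes D :: "'x \<Rightarrow> ('x, 'r::comm_ring_1) nc_tensor2"
  assumes hom: "\<And>a u v. nc_coeff2 (D a) u v \<noteq> 0 \<Longrightarrow> sum_list (map wt u) + sum_list (map wt v) = wt a"
    and pos: "\<And>a. wt a \<ge> (1::nat)"
    and fin: "\<And>n. finite {a. wt a \<le> n}"
  shows "finite {w. nc_coeff f w * nc_coeff2 (prod_list (map D w)) u v \<noteq> 0}"
proof -
  let ?wt = "\<lambda>w. sum_list (map wt w)"
  have *: "?wt u + ?wt v = ?wt w" if "nc_coeff2 (prod_list (map D w)) u v \<noteq> 0" for w u v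
    using that
  proof (induction w arbitrary: u v)
    case Nil
    then show ?case by (simp add: nc_coeff2_simps split: if_splits)
  next
    case (Cons a w)
    then obtain i j where
      "nc_coeff2 (D a) (take i u) (take j v) * nc_coeff2 (prod_list (map D w)) (drop i u) (drop j v) \<noteq> 0"
      by (auto simp: nc_coeff2_times elim!: sum.not_neutral_contains_not_neutral)
    then have "nc_coeff2 (D a) (take i u) (take j v) \<noteq> 0"
      and "nc_coeff2 (prod_list (map D w)) (drop i u) (drop j v) \<noteq> 0"
      by auto
    then have "?wt (take i u) + ?wt (take j v) = wt a" "?wt (drop i u) + ?wt (drop j v) = ?wt w"
      using hom Cons.IH by blast+
    moreover have "?wt u = ?wt (take i u) + ?wt (drop i u)" "?wt v = ?wt (take j v) + ?wt (drop j v)"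
      by (metis append_take_drop_id map_append sum_list_append)+
    ultimately show ?case by simp
  qed
  define N where "N = ?wt u + ?wt v"
  have len: "length w \<le> ?wt w" for w
  proof (induction w)
    case (Cons a w)
    then show ?case using pos [of a] by simp
  qed simp
  have sub: "set w \<subseteq> {a. wt a \<le> ?wt w}" for w
    by (auto intro: member_le_sum_list)
  have "{w. nc_coeff f w * nc_coeff2 (prod_list (map D w)) u v \<noteq> 0}
      \<subseteq> {w. set w \<subseteq> {a. wt a \<le> N} \<and> length w \<le> N}"
  proof (rule subsetI)
    fix w assume "w \<in> {w. nc_coeff f w * nc_coeff2 (prod_list (map D w)) u v \<noteq> 0}"
    then have "nc_coeff2 (prod_list (map D w)) u v \<noteq> 0" by auto
    then have "N = ?wt w" unfolding N_def by (rule *)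
    then show "w \<in> {w. set w \<subseteq> {a. wt a \<le> N} \<and> length w \<le> N}"
      using len [of w] sub [of w] by simp
  qed
  then show ?thesis
    by (rule finite_subset) (rule finite_lists_length_le [OF fin])
qed

lemma nc_coeff_var [simp]: "nc_coeff (nc_var a) w = (if w = [a] then 1 else 0)"
  by (simp add: nc_var_def)

lemma nc_coeff_Y: "nc_coeff (Y n) w \<noteq> 0 \<Longrightarrow> sum_list (map yindex w) = n"
  by (auto simp: Y_def split: if_splits)

lemma finite_UNIV_xletter: "finite (UNIV :: xletter set)"
  by (rule finite_subset [of _ "{X\<^sub>0, X\<^sub>1}"]) (auto intro: xletter.exhaust)

lemma finite_support_coprod_X:
  fixes f :: "(xletter, 'k::comm_ring_1) ncps"
  shows "finite {w. nc_coeff f w *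
     nc_coeff2 (prod_list (map (\<lambda>a. nc_var a \<otimes>\<^bsub>nc\<^esub> 1 + 1 \<otimes>\<^bsub>nc\<^esub> nc_var a) w)) u v \<noteq> 0}"
  by (rule finite_support_nc_coprod [where wt = "\<lambda>_. 1"])
     (auto simp: nc_coeff2_simps intro: finite_subset [OF subset_UNIV finite_UNIV_xletter]
        split: if_splits)

lemma finite_support_coprod_Y:
  "finite {w. nc_coeff f w *
     nc_coeff2 (prod_list (map (\<lambda>a. \<Sum>i\<le>yindex a. Y i \<otimes>\<^bsub>nc\<^esub> Y (yindex a - i)) w)) u v \<noteq> (0::'k::comm_ring_1)}"
proof (rule finite_support_nc_coprod [where wt = yindex])
  fix a u v
  assume "nc_coeff2 (\<Sum>i\<le>yindex a. Y i \<otimes>\<^bsub>nc\<^esub> Y (yindex a - i)) u v \<noteq> (0::'k)"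
  then obtain i where i: "i \<le> yindex a" "nc_coeff (Y i) u * nc_coeff (Y (yindex a - i)) v \<noteq> (0::'k)"
    by (auto simp: nc_coeff2_sum nc_coeff2_simps elim!: sum.not_neutral_contains_not_neutral)
  then have "nc_coeff (Y i) u \<noteq> (0::'k)" "nc_coeff (Y (yindex a - i)) v \<noteq> (0::'k)" by auto
  then show "sum_list (map yindex u) + sum_list (map yindex v) = yindex a"
    using i(1) by (simp add: nc_coeff_Y)
next
  show "yindex a \<ge> 1" for a by (cases a) simp
next
  fix n
  have "{a. yindex a \<le> n} \<subseteq> YLetter ` {..n}"
  proof (rule subsetI)
    fix a assume "a \<in> {a. yindex a \<le> n}"
    then show "a \<in> YLetter ` {..n}" by (cases a) auto
  qed
  then show "finite {a. yindex a \<le> n}" by (rule finite_subset) simp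
qed

lemma nc_coprod_var: "nc_coprod D (nc_var a) = D a"
proof -
  have "Sum_any (\<lambda>w. nc_coeff (nc_var a) w * nc_coeff2 (prod_list (map D w)) u v) = nc_coeff2 (D a) u v" for u v
    by (subst Sum_any.expand_superset [of "{[a]}"]) auto
  then show ?thesis
    by (auto simp: nc_coprod_def nc_coeff2_def intro!: ncps_eqI)
qed

lemma coprod_X_var: "coprod_X (nc_var a) = nc_var a \<otimes>\<^bsub>nc\<^esub> 1 + 1 \<otimes>\<^bsub>nc\<^esub> nc_var a"
  by (simp add: coprod_X_def nc_coprod_var)

lemma coprod_Y_Y: "n > 0 \<Longrightarrow> coprod_Y (Y n) = (\<Sum>i\<le>n. Y i \<otimes>\<^bsub>nc\<^esub> Y (n - i))"
  by (cases n) (simp_all add: coprod_Y_def Y_def [of "Suc _"] nc_coprod_var)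

lemma nc_coprod_1: "nc_coprod D 1 = 1"
proof -
  have "Sum_any (\<lambda>w. nc_coeff 1 w * nc_coeff2 (prod_list (map D w)) u v) = nc_coeff2 1 u v" for u v
    by (subst Sum_any.expand_superset [of "{[]}"]) auto
  then show ?thesis
    by (auto simp: nc_coprod_def nc_coeff2_def intro!: ncps_eqI)
qed

lemma fps2_power_eq_0:
  fixes p :: "'k::comm_ring_1 fps fps"
  assumes "fps_nth (fps_nth p 0) 0 = 0" "i + j < n"
  shows "fps_nth (fps_nth (p ^ n) j) i = 0"
  using assms(2)
proof (induction n arbitrary: i j)
  case (Suc n)
  have "fps_nth (fps_nth p a) b * fps_nth (fps_nth (p ^ n) (j - a)) (i - b) = 0"
    if "a \<le> j" "b \<le> i" for a b
  proof (cases "a = 0 \<and> b = 0")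
    case False
    then have "i - b + (j - a) < n" using that Suc.prems by linarith
    then show ?thesis using Suc.IH by simp
  qed (use assms(1) in simp)
  then show ?case
    by (simp add: fps_mult_nth fps_sum_nth)
qed simp

lemma finite_support_fps2_subst:
  fixes p :: "'k::comm_ring_1 fps fps"
  assumes "fps_nth (fps_nth p 0) 0 = 0"
  shows "finite {n. fps_nth g n * fps_nth (fps_nth (p ^ n) j) i \<noteq> 0}"
proof (rule finite_subset)
  show "{n. fps_nth g n * fps_nth (fps_nth (p ^ n) j) i \<noteq> 0} \<subseteq> {..i + j}"
    using fps2_power_eq_0 [OF assms] by (force simp: not_less [symmetric])
qed simp

lemma fps2_subst_const:
  fixes p :: "'k::comm_ring_1 fps fps"
  assumes "fps_nth (fps_nth p 0) 0 = 0"
  shows "fps_nth (fps_nth (fps2_subst g p) 0) 0 = fps_nth g 0"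
proof -
  have "fps_nth (fps_nth (p ^ n) 0) 0 = 0" if "n \<noteq> 0" for n
    using fps2_power_eq_0 [OF assms, of 0 0 n] that by simp
  then show ?thesis
    unfolding fps2_subst_def
    by simp (subst Sum_any.expand_superset [of "{0}"]; force)
qed

lemma fps2_divide_mult:
  fixes f g :: "'k::field fps fps"
  assumes "fps_nth (fps_nth g 0) 0 \<noteq> 0"
  shows "f / g * g = f"
proof -
  have deg: "subdegree g = 0"
    using assms by (intro subdegree_eq_0) auto
  have "fps_nth g 0 * inverse (fps_nth g 0) = 1"
    using assms by (rule inverse_mult_eq_1')
  then have "g * inverse g = 1"
    unfolding fps_inverse_def [of g] by (rule fps_right_inverse)
  then have "inverse g * g = 1"
    by (simp add: mult.commute)
  then show ?thesis
    by (simp add: fps_divide_def deg mult.assoc)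
qed

lemma fps2_nth_times_x0_x1:
  "fps_nth (fps_nth (x0 * f) j) i = (if i = 0 then 0 else fps_nth (fps_nth f j) (i - 1))"
  "fps_nth (fps_nth (x1 * f) j) i = (if j = 0 then 0 else fps_nth (fps_nth f (j - 1)) i)"
  by (simp_all add: x0_def x1_def)

lemma abelianize_word:
  "fps_nth (fps_nth (prod_list (map (\<lambda>a. case a of X\<^sub>0 \<Rightarrow> x0 | X\<^sub>1 \<Rightarrow> x1) w)) j) i =
    (if i = count_list w X\<^sub>0 \<and> j = count_list w X\<^sub>1 then 1 else (0::'k::comm_ring_1))"
proof (induction w arbitrary: i j)
  case (Cons a w)
  then show ?case
    by (cases a) (auto simp: fps2_nth_times_x0_x1)
qed simp

lemma finite_support_abelianize:
  "finite {w. nc_coeff h w *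
     fps_nth (fps_nth (prod_list (map (\<lambda>a. case a of X\<^sub>0 \<Rightarrow> x0 | X\<^sub>1 \<Rightarrow> x1) w)) j) i
       \<noteq> (0::'k::comm_ring_1)}"
proof -
  have len: "length w = count_list w X\<^sub>0 + count_list w X\<^sub>1" for w
  proof (induction w)
    case (Cons a w)
    then show ?case by (cases a) auto
  qed simp
  have "finite {w. set w \<subseteq> (UNIV :: xletter set) \<and> length w \<le> i + j}"
    by (rule finite_lists_length_le [OF finite_UNIV_xletter])
  then show ?thesis
    by (rule rev_finite_subset) (auto simp: abelianize_word len)
qed

lemma nc_coeff_times_var:
  "nc_coeff (f * nc_var a) w = (if w \<noteq> [] \<and> last w = a then nc_coeff f (butlast w) else 0)"
proof (cases w rule: rev_cases)
  case (snoc v b)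
  have "nc_coeff (f * nc_var a) w =
      (\<Sum>i\<le>length w. if i = length v then nc_coeff f v * (if b = a then 1 else 0) else 0)"
    unfolding nc_coeff_times nc_coeff_var
  proof (rule sum.cong [OF refl])
    fix i assume "i \<in> {..length w}"
    then consider "i = length v" | "i = Suc (length v)" | "i < length v"
      using snoc by force
    then show "nc_coeff f (take i w) * (if drop i w = [a] then 1 else 0) =
        (if i = length v then nc_coeff f v * (if b = a then 1 else 0) else 0)"
      by cases (use snoc in auto)
  qed
  then show ?thesis using snoc by simp
qed (simp add: nc_coeff_times)

lemma right_part_decomposition:
  fixes \<phi> :: "(xletter, 'k::ring_1) ncps"
  assumes "nc_coeff \<phi> [] = 1"
  shows "\<phi> = 1 + right_part X\<^sub>0 \<phi> * nc_var X\<^sub>0 + right_part X\<^sub>1 \<phi> * nc_var X\<^sub>1"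
proof (rule ncps_eqI)
  fix w
  show "nc_coeff \<phi> w = nc_coeff (1 + right_part X\<^sub>0 \<phi> * nc_var X\<^sub>0 + right_part X\<^sub>1 \<phi> * nc_var X\<^sub>1) w"
  proof (cases w rule: rev_cases)
    case (snoc v b)
    then show ?thesis by (cases b) (simp_all add: nc_coeff_times_var right_part_def)
  qed (simp add: nc_coeff_times_var assms)
qed

lemma right_part_unique:
  fixes \<phi> :: "(xletter, 'k::ring_1) ncps"
  assumes "\<phi> = 1 + f * nc_var X\<^sub>0 + g * nc_var X\<^sub>1"
  shows "f = right_part X\<^sub>0 \<phi>" "g = right_part X\<^sub>1 \<phi>"
  by (auto intro!: ncps_eqI simp: assms right_part_def nc_coeff_times_var)

lemma nc_coeff_geometric:
  assumes "nc_coeff q [] = 0" "length w \<le> N"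
  shows "nc_coeff (\<Sum>n\<le>N. q ^ n) w = nc_coeff (\<Sum>n\<le>length w. q ^ n) w"
proof -
  have "nc_coeff (q ^ n) w = 0" if "n \<in> {..N} - {..length w}" for n
    using that by (intro nc_coeff_power_eq_0 [OF assms(1)]) auto
  then show ?thesis
    unfolding nc_coeff_sum by (intro sum.mono_neutral_right) (use assms(2) in auto)
qed

lemma nc_inverse_mult:
  fixes f :: "('x, 'r::ring_1) ncps"
  assumes "nc_coeff f [] = 1"
  shows "f * nc_inverse f = 1" "nc_inverse f * f = 1"
proof -
  define q where "q = 1 - f"
  define g where "g = Abs_ncps (\<lambda>w. nc_coeff (\<Sum>n\<le>length w. q ^ n) w)"
  have q0: "nc_coeff q [] = 0" by (simp add: q_def assms)
  have f: "f = 1 - q" by (simp add: q_def)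
  have tel1: "f * (\<Sum>n\<le>N. q ^ n) = 1 - q ^ Suc N" for N
  proof (induction N)
    case (Suc N)
    have "f * (\<Sum>n\<le>Suc N. q ^ n) = f * (\<Sum>n\<le>N. q ^ n) + f * q ^ Suc N"
      by (simp only: sum.atMost_Suc distrib_left)
    also have "\<dots> = 1 - q ^ Suc N + (1 - q) * q ^ Suc N"
      by (simp only: Suc.IH f [symmetric])
    also have "\<dots> = 1 - q ^ Suc (Suc N)"
      by (simp add: left_diff_distrib)
    finally show ?case .
  qed (simp add: f)
  have tel2: "(\<Sum>n\<le>N. q ^ n) * f = 1 - q ^ Suc N" for N
  proof (induction N)
    case (Suc N)
    have "(\<Sum>n\<le>Suc N. q ^ n) * f = (\<Sum>n\<le>N. q ^ n) * f + q ^ Suc N * f"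
      by (simp only: sum.atMost_Suc distrib_right)
    also have "\<dots> = 1 - q ^ Suc N + q ^ Suc N * (1 - q)"
      by (simp only: Suc.IH f [symmetric])
    also have "\<dots> = 1 - q ^ Suc (Suc N)"
      by (simp add: right_diff_distrib mult.assoc power_commutes)
    finally show ?case .
  qed (simp add: f)
  have g: "nc_coeff g v = nc_coeff (\<Sum>n\<le>N. q ^ n) v" if "length v \<le> N" for v N
    using nc_coeff_geometric [OF q0 that] by (simp add: g_def)
  have "f * g = 1"
  proof (rule ncps_eqI)
    fix w
    have "nc_coeff (f * g) w = nc_coeff (f * (\<Sum>n\<le>length w. q ^ n)) w"
      unfolding nc_coeff_times by (intro sum.cong refl) (simp add: g [where N = "length w"])
    then show "nc_coeff (f * g) w = nc_coeff 1 w"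
      unfolding tel1 tel2 using nc_coeff_power_eq_0 [OF q0, of w "Suc (length w)"] by simp
  qed
  moreover have "g * f = 1"
  proof (rule ncps_eqI)
    fix w
    have "nc_coeff (g * f) w = nc_coeff ((\<Sum>n\<le>length w. q ^ n) * f) w"
      unfolding nc_coeff_times by (intro sum.cong refl) (simp add: g [where N = "length w"])
    then show "nc_coeff (g * f) w = nc_coeff 1 w"
      unfolding tel1 tel2 using nc_coeff_power_eq_0 [OF q0, of w "Suc (length w)"] by simp
  qed
  ultimately show "f * nc_inverse f = 1" "nc_inverse f * f = 1"
    by (simp_all add: nc_inverse_eqI)
qed

lemma nc_subst_const:
  assumes "nc_coeff p [] = 0"
  shows "nc_coeff (nc_subst g p) [] = fps_nth g 0"
proof -
  have "nc_coeff (p ^ n) [] = 0" if "n \<noteq> 0" for n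
    using nc_coeff_power_eq_0 [OF assms, of "[]" n] that by simp
  then show ?thesis
    unfolding nc_subst_def
    by simp (subst Sum_any.expand_superset [of "{0}"]; force)
qed


end

theory Submission
  imports Defs
begin

text \<open>
  Give the letter \<open>Y\<^sub>n\<close> the value \<open>- x\<^sub>1 x\<^sub>0\<^bsup>n-1\<^esup>\<close>. Up to sign
  this is the abelianization of \<open>X\<^sub>0\<^bsup>n-1\<^esup>X\<^sub>1\<close>, and the sign cancels the one in \<open>\<pi>\<^sub>Y\<close>.
  So this evaluation \<open>\<Theta>\<close>, an algebra homomorphism, sends \<open>\<pi>\<^sub>Y(\<phi>)\<close> to the
  meta-abelian quotient \<open>B\<close>, and it remains to evaluate the two other series in
  \<open>\<phi>\<^sub>* = \<phi>\<^bsub>corr\<^esub> \<pi>\<^sub>Y(\<phi>)\<close>.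

  Let \<open>p\<^sub>n\<close> be the coefficient of \<open>Y\<^sub>n\<close> in \<open>\<phi>\<^sub>*\<close> and
  \<open>\<Gamma>(s) = exp (\<Sum>\<^sub>n p\<^sub>n s\<^sup>n / n)\<close>. Writing \<open>- x\<^sub>1 = x - z\<close> with \<open>x = x\<^sub>0\<close> and
  \<open>z = x\<^sub>0 + x\<^sub>1\<close> reveals the shape of the answer. The coefficients of a series that is
  group-like for \<open>\<Delta>\<^sub>*\<close> form a character of the quasi-shuffle algebra, that is, of the
  quasi-symmetric functions, where words are monomial quasi-symmetric functions and
  \<open>p\<^sub>n\<close> is the value of the \<open>n\<close>-th power sum. The sum of all words
  weighted by \<open>\<Theta>\<close> is the generating function
  \<open>\<Prod>\<^sub>i (1 - z t\<^sub>i) / (1 - x t\<^sub>i) = exp (\<Sum>\<^sub>n p\<^sub>n (x\<^sup>n - z\<^sup>n) / n)\<close>,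
  which is symmetric, so only power sums occur: \<open>\<Theta>(\<phi>\<^sub>*) = \<Gamma>(x\<^sub>0) / \<Gamma>(x\<^sub>0 + x\<^sub>1)\<close>.
  Comparison of coefficients shows that the correction term is \<open>\<Gamma>(-Y\<^sub>1)\<^sup>-\<^sup>1\<close>, whence
  \<open>\<Theta>(\<phi>\<^bsub>corr\<^esub>) = \<Gamma>(x\<^sub>1)\<^sup>-\<^sup>1\<close> and the factorisation of \<open>B\<close>.

  The formula for \<open>\<Theta>(\<phi>\<^sub>*)\<close> is proved without symmetric functions, from the part of the
  group-like condition in which one tensor factor is a single letter. With a
  parameter \<open>t\<close> recording the weight it gives a linear differential equation in \<open>t\<close>,
  the analogue of Newton's identities
  (\<open>deriv_graded_ab_group_like\<close>), whose solution is unique. The combinatorial core is the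
  count \<open>sum_contractions_value\<close>. Setting \<open>t = 1\<close> (\<open>collapse_mult\<close>) returns to series in
  \<open>x\<^sub>0\<close> and \<open>x\<^sub>1\<close>.

  Uniqueness of \<open>\<Gamma>\<close> also comes from a differential equation: the part of
  \<open>B(x\<^sub>0,x\<^sub>1) \<Gamma>(x\<^sub>0 + x\<^sub>1) = \<Gamma>(x\<^sub>0) \<Gamma>(x\<^sub>1)\<close> linear in \<open>x\<^sub>1\<close> determines \<open>\<Gamma>' / \<Gamma>\<close> from \<open>B\<close>
  (\<open>gamma_element_deriv\<close>).
\<close>

section \<open>Substitution and linear differential equations\<close>

lemma nc_coeff_subst_sum:
  assumes "nc_coeff p [] = 0" "length w \<le> M"
  shows "nc_coeff (nc_subst g p) w = (\<Sum>n\<le>M. fps_nth g n * nc_coeff (p ^ n) w)"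
proof -
  have "fps_nth g n * nc_coeff (p ^ n) w = 0" if "n \<notin> {..M}" for n
    using nc_coeff_power_eq_0 [OF assms(1), of w n] that assms(2) by simp
  then have "{n. fps_nth g n * nc_coeff (p ^ n) w \<noteq> 0} \<subseteq> {..M}"
    by blast
  then show ?thesis
    by (simp add: nc_subst_def Sum_any.expand_superset)
qed

lemma nc_subst_1 [simp]:
  assumes "nc_coeff p [] = 0"
  shows "nc_subst 1 p = 1"
proof (rule ncps_eqI)
  fix w
  show "nc_coeff (nc_subst 1 p) w = nc_coeff 1 w"
    by (subst nc_coeff_subst_sum [OF assms order_refl])
       (simp add: if_distrib [of "\<lambda>c. c * _"] cong: if_cong)
qed

lemma nc_subst_uminus_X:
  assumes "nc_coeff p [] = 0"
  shows "nc_subst (- fps_X) p = - p"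
proof (rule ncps_eqI)
  fix w
  have "nc_coeff (nc_subst (- fps_X) p) w = (\<Sum>n\<le>Suc (length w). if n = 1 then - nc_coeff p w else 0)"
    unfolding nc_coeff_subst_sum [OF assms le_SucI [OF order_refl]] by (rule sum.cong) auto
  then show "nc_coeff (nc_subst (- fps_X) p) w = nc_coeff (- p) w"
    by (cases w) (simp_all add: assms Suc_le_eq)
qed

lemma nc_subst_mult:
  fixes p :: "('x, 'r::comm_ring_1) ncps"
  assumes p: "nc_coeff p [] = 0"
  shows "nc_subst (g * h) p = nc_subst g p * nc_subst h p"
proof (rule ncps_eqI)
  fix w :: "'x list"
  let ?M = "length w"
  let ?c = "\<lambda>a b. fps_nth g a * fps_nth h b * nc_coeff (p ^ (a + b)) w"
  have "nc_coeff (nc_subst g p * nc_subst h p) w =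
      (\<Sum>i\<le>?M. (\<Sum>a\<le>?M. fps_nth g a * nc_coeff (p ^ a) (take i w)) *
        (\<Sum>b\<le>?M. fps_nth h b * nc_coeff (p ^ b) (drop i w)))"
    unfolding nc_coeff_times by (simp add: nc_coeff_subst_sum [OF p, where M = ?M])
  also have "\<dots> = (\<Sum>a\<le>?M. \<Sum>b\<le>?M. ?c a b)"
    unfolding sum_product power_add nc_coeff_times
    by (subst sum.swap, rule sum.cong [OF refl], subst sum.swap, rule sum.cong [OF refl])
       (simp add: sum_distrib_left mult_ac)
  also have "\<dots> = (\<Sum>(a,b)\<in>{..?M} \<times> {..?M}. ?c a b)"
    by (simp add: sum.cartesian_product)
  \<comment> \<open>Each factor may be truncated at the length of the word; the surplus terms vanish because \<open>p\<^sup>n\<close>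
    has no words shorter than \<open>n\<close>.\<close>
  also have "\<dots> = (\<Sum>(a,b)\<in>{(a,b). a + b \<le> ?M}. ?c a b)"
    by (rule sum.mono_neutral_right) (force simp: not_less [symmetric] nc_coeff_power_eq_0 [OF p])+
  also have "\<dots> = (\<Sum>n\<le>?M. \<Sum>a\<le>n. ?c a (n - a))"
    by (rule sum.triangle_reindex_eq)
  also have "\<dots> = nc_coeff (nc_subst (g * h) p) w"
    by (simp add: nc_coeff_subst_sum [OF p order_refl] fps_mult_nth sum_distrib_right atLeast0AtMost)
  finally show "nc_coeff (nc_subst (g * h) p) w = nc_coeff (nc_subst g p * nc_subst h p) w" ..
qed

lemma nc_subst_power:
  fixes p :: "('x, 'r::comm_ring_1) ncps"
  assumes "nc_coeff p [] = 0"
  shows "nc_subst (g ^ n) p = nc_subst g p ^ n"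
  by (induction n) (simp_all add: assms nc_subst_mult)

lemma nc_subst_compose:
  fixes p :: "('x, 'r::comm_ring_1) ncps"
  assumes p: "nc_coeff p [] = 0" and h: "fps_nth h 0 = 0"
  shows "nc_subst g (nc_subst h p) = nc_subst (g oo h) p"
proof (rule ncps_eqI)
  fix w :: "'x list"
  let ?M = "length w"
  have hp: "nc_coeff (nc_subst h p) [] = 0"
    using nc_subst_const [OF p] h by simp
  have "nc_coeff (nc_subst g (nc_subst h p)) w =
      (\<Sum>n\<le>?M. fps_nth g n * (\<Sum>m\<le>?M. fps_nth (h ^ n) m * nc_coeff (p ^ m) w))"
    by (simp add: nc_coeff_subst_sum [OF hp order_refl] nc_subst_power [OF p, symmetric]
        nc_coeff_subst_sum [OF p order_refl])
  also have "\<dots> = (\<Sum>m\<le>?M. (\<Sum>n\<le>?M. fps_nth g n * fps_nth (h ^ n) m) * nc_coeff (p ^ m) w)"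
    unfolding sum_distrib_left sum_distrib_right by (subst sum.swap) (simp add: mult_ac)
  also have "\<dots> = (\<Sum>m\<le>?M. fps_nth (g oo h) m * nc_coeff (p ^ m) w)"
  proof (rule sum.cong [OF refl])
    fix m assume "m \<in> {..?M}"
    then have "(\<Sum>n\<le>?M. fps_nth g n * fps_nth (h ^ n) m) = (\<Sum>n\<in>{0..m}. fps_nth g n * fps_nth (h ^ n) m)"
      by (intro sum.mono_neutral_right) (auto simp: startsby_zero_power_prefix [OF h])
    then show "(\<Sum>n\<le>?M. fps_nth g n * fps_nth (h ^ n) m) * nc_coeff (p ^ m) w =
        fps_nth (g oo h) m * nc_coeff (p ^ m) w"
      by (simp add: fps_compose_nth)
  qed
  also have "\<dots> = nc_coeff (nc_subst (g oo h) p) w"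
    by (simp add: nc_coeff_subst_sum [OF p order_refl])
  finally show "nc_coeff (nc_subst g (nc_subst h p)) w = nc_coeff (nc_subst (g oo h) p) w" .
qed

lemma nc_coeff_var_power: "nc_coeff (nc_var a ^ n) w = (if w = replicate n a then 1 else 0)"
proof (induction n arbitrary: w)
  case (Suc n)
  have snoc_replicate: "replicate (Suc n) a = replicate n a @ [a]"
    by (simp add: replicate_append_same)
  show ?case
  proof (cases w rule: rev_cases)
    case (snoc v b)
    then show ?thesis
      unfolding power_Suc2 nc_coeff_times_var Suc.IH snoc_replicate by auto
  qed (simp add: power_Suc2 nc_coeff_times_var del: power_Suc)
qed simp

lemma fps_linear_ODE_unique:
  fixes u v q :: "'a::{idom,semiring_char_0} fps"
  assumes u: "fps_deriv u = q * u" and v: "fps_deriv v = q * v" and "fps_nth u 0 = fps_nth v 0"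
  shows "u = v"
proof (rule fps_ext)
  fix n
  show "fps_nth u n = fps_nth v n"
  proof (induction n rule: less_induct)
    case (less n)
    show ?case
    proof (cases n)
      case (Suc m)
      have "fps_nth (q * u) m = fps_nth (q * v) m"
        unfolding fps_mult_nth using less Suc by (intro sum.cong) auto
      then have "of_nat n * fps_nth u n = of_nat n * fps_nth v n"
        using arg_cong [OF u, of "\<lambda>f. fps_nth f m"] arg_cong [OF v, of "\<lambda>f. fps_nth f m"] Suc
        by (simp del: of_nat_Suc)
      then show ?thesis using Suc by (simp del: of_nat_Suc)
    qed (use assms in simp)
  qed
qed

section \<open>Contracting a letter in a quasi-shuffle\<close>

definition weight :: "yletter list \<Rightarrow> nat" where
  "weight w = sum_list (map yindex w)"

lemma weight_simps [simp]:
  "weight [] = 0" "weight (a # w) = yindex a + weight w" "weight (v @ w) = weight v + weight w"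
  by (simp_all add: weight_def)

lemma yindex_pos [simp]: "yindex a > 0" "yindex a \<noteq> 0"
  by (cases a; simp)+

text \<open>
  The words \<open>v\<close> whose quasi-shuffle product with the single letter \<open>Y\<^sub>n\<close> contains the given word,
  listed with multiplicity: one undoes the product by deleting a letter \<open>Y\<^sub>n\<close>, or by
  replacing a letter \<open>Y\<^sub>k\<close> with \<open>k > n\<close>, into which \<open>Y\<^sub>n\<close> was merged, by \<open>Y\<^bsub>k-n\<^esub>\<close>.
\<close>

fun contractions :: "nat \<Rightarrow> yletter list \<Rightarrow> yletter list list" where
  "contractions n [] = []"
| "contractions n (a # w) = map ((#) a) (contractions n w) @
     (if yindex a = n then [w] else if n < yindex a then [YLetter (yindex a - n - 1) # w] else [])"

lemma weight_contractions: "v \<in> set (contractions n w) \<Longrightarrow> weight v + n = weight w"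
  by (induction n w arbitrary: v rule: contractions.induct)
     (auto simp: add_ac split: if_splits)

abbreviation letter_coprod :: "yletter \<Rightarrow> (yletter, 'k::comm_ring_1) nc_tensor2" where
  "letter_coprod a \<equiv> \<Sum>i\<le>yindex a. Y i \<otimes>\<^bsub>nc\<^esub> Y (yindex a - i)"

lemma Y_yindex: "Y (yindex a) = nc_var a"
  by (cases a) (simp add: Y_def)

lemma letter_coprod_Nil: "nc_coeff2 (letter_coprod a) [] v = (if v = [a] then 1 else (0::'k::comm_ring_1))"
proof -
  have "nc_coeff2 (letter_coprod a) [] v =
      (\<Sum>i\<le>yindex a. if i = 0 then nc_coeff (Y (yindex a)) v else (0::'k))"
    unfolding nc_coeff2_sum nc_coeff2_simps by (rule sum.cong) (auto simp: Y_def)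
  then show ?thesis by (simp add: Y_yindex)
qed

lemma letter_coprod_single:
  assumes "n > 0"
  shows "nc_coeff2 (letter_coprod a) [YLetter (n - 1)] v =
    (if n \<le> yindex a then nc_coeff (Y (yindex a - n)) v else (0::'k::comm_ring_1))"
proof -
  have "nc_coeff2 (letter_coprod a) [YLetter (n - 1)] v =
      (\<Sum>i\<le>yindex a. if i = n then nc_coeff (Y (yindex a - n)) v else (0::'k))"
    unfolding nc_coeff2_sum nc_coeff2_simps using assms
    by (intro sum.cong) (cases n; cases a; auto simp: Y_def)+
  then show ?thesis by simp
qed

lemma sum_take_single:
  "(\<Sum>j\<le>length v. (if take j v = [a] then 1 else 0) * g (drop j v)) =
    (if v \<noteq> [] \<and> hd v = a then g (tl v) else (0::'k::comm_ring_1))"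
proof (cases v)
  case (Cons c v')
  have "(\<Sum>j\<le>length v. (if take j v = [a] then 1 else 0) * g (drop j v)) =
      (\<Sum>j\<le>length v. if j = 1 then (if c = a then g v' else 0) else 0)"
    by (rule sum.cong) (auto simp: Cons take_Cons drop_Cons split: nat.splits)
  then show ?thesis using Cons by (cases v') (simp_all add: Suc_le_eq)
qed simp

lemma sum_take_Nil:
  "(\<Sum>j\<le>length v. (if take j v = [] then 1 else 0) * g (drop j v)) = (g v :: 'k::comm_ring_1)"
proof -
  have "(\<Sum>j\<le>length v. (if take j v = [] then 1 else 0) * g (drop j v)) =
      (\<Sum>j\<le>length v. if j = 0 then g v else 0)"
    by (rule sum.cong) auto
  then show ?thesis by simp
qed

lemma word_coprod_Nil:
  "nc_coeff2 (prod_list (map letter_coprod w)) [] v = (if v = w then 1 else (0::'k::comm_ring_1))"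
proof (induction w arbitrary: v)
  case (Cons a w)
  show ?case
    using sum_take_single [of v a "\<lambda>u. if u = w then 1 else (0::'k)"]
    by (cases v) (auto simp: nc_coeff2_times letter_coprod_Nil Cons.IH)
qed (simp add: nc_coeff2_simps)

lemma count_list_map_Cons:
  "count_list (map ((#) a) xs) v = (if v \<noteq> [] \<and> hd v = a then count_list xs (tl v) else 0)"
  by (induction xs) auto

text \<open>
  A word can be split by \<open>\<Delta>\<^sub>*\<close> with a single letter \<open>Y\<^sub>n\<close> on the left only if one of its letters
  contributes this \<open>Y\<^sub>n\<close> and all others go entirely to the right.
\<close>

lemma word_coprod_single:
  assumes n: "n > 0"
  shows "nc_coeff2 (prod_list (map letter_coprod w)) [YLetter (n - 1)] v =
    (of_nat (count_list (contractions n w) v) :: 'k::comm_ring_1)"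
proof (induction w arbitrary: v)
  case (Cons a w)
  let ?T = "prod_list (map letter_coprod w) :: (yletter, 'k) nc_tensor2"
  have "nc_coeff2 (prod_list (map letter_coprod (a # w))) [YLetter (n - 1)] v =
      (\<Sum>j\<le>length v. nc_coeff2 (letter_coprod a) [] (take j v) * nc_coeff2 ?T [YLetter (n - 1)] (drop j v))
    + (\<Sum>j\<le>length v. nc_coeff2 (letter_coprod a) [YLetter (n - 1)] (take j v) * nc_coeff2 ?T [] (drop j v))"
    by (simp add: nc_coeff2_times)
  also have "(\<Sum>j\<le>length v. nc_coeff2 (letter_coprod a) [] (take j v) * nc_coeff2 ?T [YLetter (n - 1)] (drop j v))
      = of_nat (count_list (map ((#) a) (contractions n w)) v)"
    unfolding letter_coprod_Nil Cons.IH count_list_map_Cons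
    using sum_take_single [of v a "\<lambda>u. of_nat (count_list (contractions n w) u) :: 'k"] by simp
  also have "(\<Sum>j\<le>length v. nc_coeff2 (letter_coprod a) [YLetter (n - 1)] (take j v) * nc_coeff2 ?T [] (drop j v))
      = of_nat (count_list (if yindex a = n then [w]
          else if n < yindex a then [YLetter (yindex a - n - 1) # w] else []) v)"
  proof -
    consider "yindex a = n" | "n < yindex a" | "yindex a < n" by linarith
    then show ?thesis
    proof cases
      case 1
      then show ?thesis
        unfolding letter_coprod_single [OF n] word_coprod_Nil
        using sum_take_Nil [of v "\<lambda>u. if u = w then 1 else (0::'k)"] by (simp add: Y_def)
    next
      case 2
      then have "(Y (yindex a - n) :: (yletter, 'k) ncps) = nc_var (YLetter (yindex a - n - 1))"
        by (simp add: Y_def)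
      then show ?thesis
        unfolding letter_coprod_single [OF n] word_coprod_Nil
        using 2 sum_take_single [of v "YLetter (yindex a - n - 1)" "\<lambda>u. if u = w then 1 else (0::'k)"]
        by (cases v) auto
    next
      case 3
      then show ?thesis
        unfolding letter_coprod_single [OF n] by simp
    qed
  qed
  finally show ?case by (simp add: count_list_append)
qed (simp add: nc_coeff2_simps)

definition words_of_weight :: "nat \<Rightarrow> yletter list set" where
  "words_of_weight n = {w. weight w = n}"

lemma length_le_weight: "length w \<le> weight w"
proof (induction w)
  case (Cons a w)
  then show ?case using yindex_pos(1) [of a] by (simp del: yindex_pos)
qed simp

lemma finite_words_of_weight [simp]: "finite (words_of_weight n)"
proof (rule finite_subset)
  show "words_of_weight n \<subseteq> {w. set w \<subseteq> YLetter ` {..n} \<and> length w \<le> n}"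
  proof (rule subsetI)
    fix w assume "w \<in> words_of_weight n"
    then have w: "weight w = n" by (simp add: words_of_weight_def)
    have "a \<in> YLetter ` {..n}" if "a \<in> set w" for a
    proof -
      have "yindex a \<le> n"
        using member_le_sum_list [of "yindex a" "map yindex w"] that w by (simp add: weight_def)
      then show ?thesis by (cases a) auto
    qed
    then show "w \<in> {w. set w \<subseteq> YLetter ` {..n} \<and> length w \<le> n}"
      using length_le_weight [of w] w by auto
  qed
qed (simp add: finite_lists_length_le)

text \<open>
  The coefficients of a group-like series respect the quasi-shuffle product with one letter.
\<close>

lemma group_like_Y_single:
  fixes f :: "(yletter, 'k::comm_ring_1) ncps"
  assumes f: "coprod_Y f = f \<otimes>\<^bsub>nc\<^esub> f" and n: "n > 0" and v: "weight v = m"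
  shows "nc_coeff f [YLetter (n - 1)] * nc_coeff f v =
    (\<Sum>w\<in>words_of_weight (m + n). nc_coeff f w * of_nat (count_list (contractions n w) v))"
proof -
  have "nc_coeff f [YLetter (n - 1)] * nc_coeff f v = nc_coeff2 (coprod_Y f) [YLetter (n - 1)] v"
    by (simp add: f nc_coeff2_simps)
  also have "\<dots> = Sum_any (\<lambda>w. nc_coeff f w * of_nat (count_list (contractions n w) v))"
    by (simp add: coprod_Y_def nc_coprod_def nc_coeff2_def [of "Abs_ncps _"] word_coprod_single [OF n]
        del: One_nat_def)
  also have "\<dots> = (\<Sum>w\<in>words_of_weight (m + n). nc_coeff f w * of_nat (count_list (contractions n w) v))"
  proof (rule Sum_any.expand_superset)
    show "{w. nc_coeff f w * of_nat (count_list (contractions n w) v) \<noteq> 0} \<subseteq> words_of_weight (m + n)"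
    proof
      fix w assume "w \<in> {w. nc_coeff f w * of_nat (count_list (contractions n w) v) \<noteq> 0}"
      then have "v \<in> set (contractions n w)"
        by (auto intro: ccontr)
      then show "w \<in> words_of_weight (m + n)"
        using v weight_contractions by (auto simp: words_of_weight_def)
    qed
  qed simp
  finally show ?thesis .
qed

section \<open>Specialising the letters\<close>

text \<open>
  The value of \<open>Y\<^sub>n\<close> as a product with the difference \<open>x - z\<close>: this is the form in which the sums over
  contractions telescope. The instance of interest is \<open>x = x\<^sub>0\<close>, \<open>z = x\<^sub>0 + x\<^sub>1\<close>.
\<close>

definition letter_value :: "'r::comm_ring_1 \<Rightarrow> 'r \<Rightarrow> yletter \<Rightarrow> 'r" where
  "letter_value x z a = (x - z) * x ^ (yindex a - 1)"

definition word_value :: "'r::comm_ring_1 \<Rightarrow> 'r \<Rightarrow> yletter list \<Rightarrow> 'r" where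
  "word_value x z w = prod_list (map (letter_value x z) w)"

lemma word_value_simps [simp]:
  "word_value x z [] = 1"
  "word_value x z (a # w) = letter_value x z a * word_value x z w"
  "word_value x z (v @ w) = word_value x z v * word_value x z w"
  by (simp_all add: word_value_def)

text \<open>
  The contribution of one letter \<open>Y\<^bsub>k+1\<^esub>\<close> to \<open>sum_contractions_value\<close>: the first sum collects the
  ways to lower its index, the last term its deletion. In
  \<open>(x - z) (\<Sum>\<^sub>i z\<^sup>i\<^sup>+\<^sup>1 x\<^bsup>k-1-i\<^esup>)\<close> everything telescopes.
\<close>

lemma sum_contracted_letter_values:
  fixes x z :: "'r::comm_ring_1"
  shows "(\<Sum>i<k. (x ^ Suc i - z ^ Suc i) * ((x - z) * x ^ (k - Suc i))) + (x ^ Suc k - z ^ Suc k) =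
    of_nat (Suc k) * ((x - z) * x ^ k)"
proof (induction k)
  case (Suc k)
  have "(\<Sum>i<k. (x ^ Suc i - z ^ Suc i) * ((x - z) * x ^ (Suc k - Suc i))) =
      x * (\<Sum>i<k. (x ^ Suc i - z ^ Suc i) * ((x - z) * x ^ (k - Suc i)))"
    unfolding sum_distrib_left
  proof (rule sum.cong [OF refl])
    fix i assume "i \<in> {..<k}"
    then have "Suc k - Suc i = Suc (k - Suc i)" by auto
    then show "(x ^ Suc i - z ^ Suc i) * ((x - z) * x ^ (Suc k - Suc i)) =
        x * ((x ^ Suc i - z ^ Suc i) * ((x - z) * x ^ (k - Suc i)))"
      by (simp add: mult_ac del: diff_Suc_Suc)
  qed
  also have "\<dots> = x * (of_nat (Suc k) * ((x - z) * x ^ k) - (x ^ Suc k - z ^ Suc k))"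
    using Suc.IH by (intro arg_cong [of _ _ "(*) x"]) (simp only: eq_diff_eq)
  finally show ?case
    by (simp add: algebra_simps)
qed simp

text \<open>
  Every letter \<open>Y\<^sub>k\<close> of the word contributes \<open>k\<close> times the value of the word, so the total is the
  weight. This is the reason why the factor \<open>x\<^sup>n - z\<^sup>n\<close> goes with the \<open>n\<close>-th power sum.
\<close>

lemma sum_contractions_value:
  fixes x z :: "'r::comm_ring_1"
  assumes "weight w \<le> M"
  shows "(\<Sum>i<M. (x ^ Suc i - z ^ Suc i) * sum_list (map (word_value x z) (contractions (Suc i) w))) =
    of_nat (weight w) * word_value x z w"
  using assms
proof (induction w)
  case (Cons a w)
  obtain k where a: "a = YLetter k" by (cases a)
  have M: "k < M" using Cons.prems a by simp
  let ?d = "\<lambda>i. x ^ Suc i - z ^ Suc i"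
  let ?g = "\<lambda>i. if i = k then 1 else if i < k then (x - z) * x ^ (k - Suc i) else 0"
  \<comment> \<open>\<open>?g i\<close> is the value of what \<open>Y\<^bsub>k+1\<^esub>\<close> becomes when \<open>Y\<^bsub>i+1\<^esub>\<close> is removed from it.\<close>
  have "sum_list (map (word_value x z) (contractions (Suc i) (a # w))) =
      letter_value x z a * sum_list (map (word_value x z) (contractions (Suc i) w)) +
      ?g i * word_value x z w" for i
    by (auto simp: a letter_value_def sum_list_const_mult o_def Suc_diff_Suc)
  then have "(\<Sum>i<M. ?d i * sum_list (map (word_value x z) (contractions (Suc i) (a # w)))) =
      letter_value x z a * (\<Sum>i<M. ?d i * sum_list (map (word_value x z) (contractions (Suc i) w))) +
      (\<Sum>i<M. ?d i * ?g i) * word_value x z w"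
    by (simp add: distrib_left sum.distrib sum_distrib_left sum_distrib_right mult_ac
        del: power_Suc contractions.simps)
  also have "(\<Sum>i<M. ?d i * ?g i) = (\<Sum>i<Suc k. ?d i * ?g i)"
    using M by (intro sum.mono_neutral_right) auto
  also have "\<dots> = (\<Sum>i<k. ?d i * ((x - z) * x ^ (k - Suc i))) + ?d k"
    by (simp del: power_Suc)
  also have "\<dots> = of_nat (Suc k) * letter_value x z a"
    unfolding sum_contracted_letter_values by (simp add: a letter_value_def)
  finally show ?case
    using Cons by (simp add: a algebra_simps)
qed simp

section \<open>Homogeneous bivariate series\<close>

definition fps2_const :: "'k::comm_ring_1 \<Rightarrow> 'k fps fps" where
  "fps2_const c = fps_const (fps_const c)"

lemma fps2_const_simps [simp]:
  "fps2_const 0 = 0" "fps2_const 1 = 1"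
  "fps2_const (b * c) = fps2_const b * fps2_const c"
  by (simp_all add: fps2_const_def fps_const_mult [symmetric] del: fps_const_mult)

lemma fps2_const_sum: "fps2_const (sum f A) = (\<Sum>a\<in>A. fps2_const (f a))"
  by (induction A rule: infinite_finite_induct) (simp_all add: fps2_const_def flip: fps_const_add)

lemma fps2_const_of_nat [simp]: "fps2_const (of_nat n) = of_nat n"
  by (simp add: fps2_const_def fps_of_nat)

lemma fps2_nth_const_mult [simp]:
  "fps_nth (fps_nth (fps2_const c * f) j) i = c * fps_nth (fps_nth f j) i"
  by (simp add: fps2_const_def)

lemma fps2_mult_nth:
  "fps_nth (fps_nth (f * g) j) i =
    (\<Sum>b\<le>j. \<Sum>a\<le>i. fps_nth (fps_nth f b) a * fps_nth (fps_nth g (j - b)) (i - a))"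
  by (simp add: fps_mult_nth fps_sum_nth atLeast0AtMost)

definition homogeneous :: "nat \<Rightarrow> 'k::comm_ring_1 fps fps \<Rightarrow> bool" where
  "homogeneous n f \<longleftrightarrow> (\<forall>i j. i + j \<noteq> n \<longrightarrow> fps_nth (fps_nth f j) i = 0)"

lemma homogeneous_1: "homogeneous 0 1"
  by (auto simp: homogeneous_def)

lemma homogeneous_vars: "homogeneous 1 x0" "homogeneous 1 x1" "homogeneous 1 (x0 + x1)"
  by (auto simp: homogeneous_def x0_def x1_def fps_X_nth)

lemma homogeneous_uminus: "homogeneous n f \<Longrightarrow> homogeneous n (- f)"
  by (simp add: homogeneous_def)

lemma homogeneous_const_mult: "homogeneous n f \<Longrightarrow> homogeneous n (fps2_const c * f)"
  by (simp add: homogeneous_def)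

lemma homogeneous_sum: "(\<And>a. a \<in> A \<Longrightarrow> homogeneous n (f a)) \<Longrightarrow> homogeneous n (sum f A)"
  by (simp add: homogeneous_def fps_sum_nth)

lemma homogeneous_mult:
  assumes "homogeneous m f" "homogeneous n g"
  shows "homogeneous (m + n) (f * g)"
  unfolding homogeneous_def
proof (intro allI impI)
  fix i j assume ij: "i + j \<noteq> m + n"
  have "fps_nth (fps_nth f b) a * fps_nth (fps_nth g (j - b)) (i - a) = 0" if "b \<le> j" "a \<le> i" for a b
  proof (cases "a + b = m")
    case True
    then have "(i - a) + (j - b) \<noteq> n" using that ij by linarith
    then show ?thesis using assms(2) by (simp add: homogeneous_def)
  qed (use assms(1) in \<open>simp add: homogeneous_def\<close>)
  then show "fps_nth (fps_nth (f * g) j) i = 0"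
    by (simp add: fps2_mult_nth)
qed

lemma homogeneous_power: "homogeneous 1 f \<Longrightarrow> homogeneous n (f ^ n)"
  using homogeneous_1 homogeneous_mult [of 1 f] by (induction n) auto

text \<open>
  A series in \<open>x\<^sub>0, x\<^sub>1\<close> is represented by \<open>\<Sum>\<^sub>n F\<^sub>n t\<^sup>n\<close> with its homogeneous parts \<open>F\<^sub>n\<close> as coefficients.
  This makes derivatives with respect to the total degree available as
  derivatives in \<open>t\<close>. The series is recovered by \<open>t = 1\<close>; as only \<open>F\<^bsub>i+j\<^esub>\<close> contains
  \<open>x\<^sub>0\<^sup>i x\<^sub>1\<^sup>j\<close>, this can be defined with no infinite sum.
\<close>

definition collapse :: "'k::comm_ring_1 fps fps fps \<Rightarrow> 'k fps fps" where
  "collapse F = Abs_fps (\<lambda>j. Abs_fps (\<lambda>i. fps_nth (fps_nth (fps_nth F (i + j)) j) i))"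

lemma collapse_mult:
  assumes F: "\<And>n. homogeneous n (fps_nth F n)"
  shows "collapse (F * G) = collapse F * collapse G"
proof (intro fps_ext)
  fix i j
  let ?c = "\<lambda>m b a. fps_nth (fps_nth (fps_nth F m) b) a *
    fps_nth (fps_nth (fps_nth G (i + j - m)) (j - b)) (i - a)"
  have "fps_nth (fps_nth (collapse (F * G)) j) i = (\<Sum>m\<le>i + j. \<Sum>b\<le>j. \<Sum>a\<le>i. ?c m b a)"
    by (simp add: collapse_def fps_mult_nth [of F] fps_sum_nth fps2_mult_nth atLeast0AtMost)
  also have "\<dots> = (\<Sum>b\<le>j. \<Sum>a\<le>i. \<Sum>m\<le>i + j. ?c m b a)"
    by (subst sum.swap, rule sum.cong [OF refl], rule sum.swap)
  also have "\<dots> = (\<Sum>b\<le>j. \<Sum>a\<le>i. ?c (a + b) b a)"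
  proof (intro sum.cong refl)
    fix a b assume "b \<in> {..j}" "a \<in> {..i}"
    have "(\<Sum>m\<le>i + j. ?c m b a) = (\<Sum>m\<le>i + j. if m = a + b then ?c (a + b) b a else 0)"
      using F by (intro sum.cong) (auto simp: homogeneous_def)
    then show "(\<Sum>m\<le>i + j. ?c m b a) = ?c (a + b) b a"
      using \<open>b \<in> {..j}\<close> \<open>a \<in> {..i}\<close> by simp
  qed
  also have "\<dots> = fps_nth (fps_nth (collapse F * collapse G) j) i"
    unfolding fps2_mult_nth by (intro sum.cong refl) (auto simp: collapse_def add.commute)
  finally show "fps_nth (fps_nth (collapse (F * G)) j) i = fps_nth (fps_nth (collapse F * collapse G) j) i" .
qed

text \<open>
  The series \<open>g(p t)\<close>.
\<close>

definition graded_subst :: "'k::comm_ring_1 fps \<Rightarrow> 'k fps fps \<Rightarrow> 'k fps fps fps" where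
  "graded_subst g p = Abs_fps (\<lambda>n. fps2_const (fps_nth g n) * p ^ n)"

lemma homogeneous_graded_subst: "homogeneous 1 p \<Longrightarrow> homogeneous n (fps_nth (graded_subst g p) n)"
  by (simp add: graded_subst_def homogeneous_const_mult homogeneous_power)

lemma collapse_graded_subst:
  assumes "homogeneous 1 p"
  shows "collapse (graded_subst g p) = fps2_subst g p"
proof (intro fps_ext)
  fix i j
  have "fps_nth (fps_nth (p ^ n) j) i = 0" if "n \<noteq> i + j" for n
    using homogeneous_power [OF assms, of n] that by (simp add: homogeneous_def)
  then have "Sum_any (\<lambda>n. fps_nth g n * fps_nth (fps_nth (p ^ n) j) i) =
      (\<Sum>n\<in>{i + j}. fps_nth g n * fps_nth (fps_nth (p ^ n) j) i)"
    by (intro Sum_any.expand_superset) force+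
  then show "fps_nth (fps_nth (collapse (graded_subst g p)) j) i = fps_nth (fps_nth (fps2_subst g p) j) i"
    by (simp add: collapse_def graded_subst_def fps2_subst_def)
qed

lemma graded_subst_1 [simp]: "graded_subst 1 p = 1"
  by (rule fps_ext) (simp add: graded_subst_def)

lemma graded_subst_mult: "graded_subst (g * h) p = graded_subst g p * graded_subst h p"
proof (rule fps_ext)
  fix n
  have "fps_nth (graded_subst (g * h) p) n =
      (\<Sum>i\<le>n. (fps2_const (fps_nth g i) * fps2_const (fps_nth h (n - i))) * p ^ n)"
    by (simp add: graded_subst_def fps_mult_nth fps2_const_sum sum_distrib_right atLeast0AtMost)
  also have "\<dots> = fps_nth (graded_subst g p * graded_subst h p) n"
    unfolding fps_mult_nth atLeast0AtMost
  proof (rule sum.cong [OF refl])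
    fix i assume "i \<in> {..n}"
    then have "p ^ n = p ^ i * p ^ (n - i)" by (simp flip: power_add)
    then show "fps2_const (fps_nth g i) * fps2_const (fps_nth h (n - i)) * p ^ n =
        fps_nth (graded_subst g p) i * fps_nth (graded_subst h p) (n - i)"
      by (simp add: graded_subst_def mult_ac)
  qed
  finally show "fps_nth (graded_subst (g * h) p) n = fps_nth (graded_subst g p * graded_subst h p) n" .
qed

lemma graded_subst_uminus: "graded_subst g (- p) = graded_subst (g oo - fps_X) p"
proof (rule fps_ext)
  fix n
  have "fps2_const ((- 1) ^ n) = ((- 1) ^ n :: 'a fps fps)"
    by (cases "even n") (simp_all add: fps2_const_def flip: fps_const_neg)
  then show "fps_nth (graded_subst g (- p)) n = fps_nth (graded_subst (g oo - fps_X) p) n"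
    by (simp add: graded_subst_def fps_compose_uminus' power_minus [of p] mult_ac)
qed

text \<open>
  The series \<open>p L(p t)\<close>, which is the logarithmic derivative of \<open>g(p t)\<close> if \<open>L\<close> is that of \<open>g\<close>.
\<close>

definition log_deriv_subst :: "'k::comm_ring_1 fps \<Rightarrow> 'k fps fps \<Rightarrow> 'k fps fps fps" where
  "log_deriv_subst L p = Abs_fps (\<lambda>i. fps2_const (fps_nth L i) * p ^ Suc i)"

lemma deriv_graded_subst:
  assumes "fps_deriv g = L * g"
  shows "fps_deriv (graded_subst g p) = log_deriv_subst L p * graded_subst g p"
proof -
  have "fps_deriv (graded_subst g p) = fps_const p * graded_subst (fps_deriv g) p"
    by (rule fps_ext) (simp add: graded_subst_def mult_ac del: of_nat_Suc)
  moreover have "log_deriv_subst L p = fps_const p * graded_subst L p"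
    by (rule fps_ext) (simp add: graded_subst_def log_deriv_subst_def mult_ac)
  ultimately show ?thesis
    by (simp add: assms graded_subst_mult mult.assoc)
qed

section \<open>The graded abelianization of a series in the letters Y\<close>

text \<open>
  The image of a series under \<open>Y\<^sub>n \<mapsto> - x\<^sub>1 x\<^sub>0\<^bsup>n-1\<^esup> t\<^sup>n\<close>.
\<close>

definition graded_ab :: "(yletter, 'k::comm_ring_1) ncps \<Rightarrow> 'k fps fps fps" where
  "graded_ab f = Abs_fps (\<lambda>n. \<Sum>w\<in>words_of_weight n. fps2_const (nc_coeff f w) * word_value x0 (x0 + x1) w)"

lemma homogeneous_word_value: "homogeneous (weight w) (word_value x0 (x0 + x1) w)"
proof (induction w)
  case (Cons a w)
  have "homogeneous (1 + (yindex a - 1)) (- x1 * x0 ^ (yindex a - 1))"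
    by (intro homogeneous_mult homogeneous_uminus homogeneous_power homogeneous_vars)
  moreover have "1 + (yindex a - 1) = yindex a" by (cases a) simp
  ultimately have "homogeneous (yindex a) (letter_value x0 (x0 + x1) a)"
    by (simp add: letter_value_def)
  then show ?case
    using homogeneous_mult Cons.IH by fastforce
qed (simp add: homogeneous_1)

lemma homogeneous_graded_ab: "homogeneous n (fps_nth (graded_ab f) n)"
  unfolding graded_ab_def fps_nth_Abs_fps
  by (intro homogeneous_sum homogeneous_const_mult)
     (use homogeneous_word_value in \<open>auto simp: words_of_weight_def\<close>)

lemma words_of_weight_0: "words_of_weight 0 = {[]}"
proof -
  have "w = []" if "weight w = 0" for w
    using length_le_weight [of w] that by simp
  then show ?thesis by (auto simp: words_of_weight_def)
qed

lemma graded_ab_nth_0: "fps_nth (graded_ab f) 0 = fps2_const (nc_coeff f [])"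
  by (simp add: graded_ab_def words_of_weight_0)

lemma graded_ab_mult:
  fixes f g :: "(yletter, 'k::comm_ring_1) ncps"
  shows "graded_ab (f * g) = graded_ab f * graded_ab g"
proof (rule fps_ext)
  fix n
  let ?v = "word_value x0 (x0 + x1) :: yletter list \<Rightarrow> 'k fps fps"
  let ?t = "\<lambda>f w. fps2_const (nc_coeff f w) * ?v w"
  have "fps_nth (graded_ab (f * g)) n =
      (\<Sum>w\<in>words_of_weight n. \<Sum>i\<le>length w. ?t f (take i w) * ?t g (drop i w))"
    unfolding graded_ab_def fps_nth_Abs_fps nc_coeff_times fps2_const_sum sum_distrib_right
  proof (intro sum.cong refl)
    fix w i
    have "?v w = ?v (take i w) * ?v (drop i w)"
      by (metis append_take_drop_id word_value_simps(3))
    then show "fps2_const (nc_coeff f (take i w) * nc_coeff g (drop i w)) * ?v w =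
        ?t f (take i w) * ?t g (drop i w)"
      by (simp add: mult_ac)
  qed
  also have "\<dots> = (\<Sum>(w,i)\<in>(SIGMA w:words_of_weight n. {..length w}). ?t f (take i w) * ?t g (drop i w))"
    by (rule sum.Sigma) auto
  also have "\<dots> = (\<Sum>(m,u,v)\<in>(SIGMA m:{..n}. words_of_weight m \<times> words_of_weight (n - m)). ?t f u * ?t g v)"
  \<comment> \<open>A word with a cut point is the same as a pair of words.\<close>
  proof (rule sum.reindex_bij_witness [where
        i = "\<lambda>(m,u,v). (u @ v, length u)" and
        j = "\<lambda>(w,i). (weight (take i w), take i w, drop i w)"])
    fix p assume p: "p \<in> (SIGMA w:words_of_weight n. {..length w})"
    obtain w i where wi: "p = (w, i)" by (cases p)
    have "weight w = weight (take i w) + weight (drop i w)"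
      by (metis append_take_drop_id weight_simps(3))
    then show "(case p of (w, i) \<Rightarrow> (weight (take i w), take i w, drop i w)) \<in>
        (SIGMA m:{..n}. words_of_weight m \<times> words_of_weight (n - m))"
      using p wi by (auto simp: words_of_weight_def)
  qed (auto simp: words_of_weight_def)
  also have "\<dots> = (\<Sum>m\<le>n. \<Sum>(u,v)\<in>words_of_weight m \<times> words_of_weight (n - m). ?t f u * ?t g v)"
    by (subst sum.Sigma) (auto intro!: sum.cong)
  also have "\<dots> = fps_nth (graded_ab f * graded_ab g) n"
    by (simp add: fps_mult_nth graded_ab_def sum_product sum.cartesian_product atLeast0AtMost)
  finally show "fps_nth (graded_ab (f * g)) n = fps_nth (graded_ab f * graded_ab g) n" .
qed

lemma weight_replicate_Y1: "weight (replicate n (YLetter 0)) = n"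
  by (induction n) simp_all

lemma nc_coeff_subst_Y1:
  "nc_coeff (nc_subst g (Y 1)) w =
    (if w = replicate (length w) (YLetter 0) then fps_nth g (length w) else 0)"
proof -
  have Y1: "nc_coeff (Y 1 :: (yletter, 'a) ncps) [] = 0"
    by (simp add: Y_def)
  have "nc_coeff (nc_subst g (Y 1)) w =
      (\<Sum>n\<le>length w. if n = length w then
        (if w = replicate (length w) (YLetter 0) then fps_nth g (length w) else 0) else 0)"
    unfolding nc_coeff_subst_sum [OF Y1 order_refl]
    by (rule sum.cong) (auto simp: Y_def nc_coeff_var_power)
  then show ?thesis by simp
qed

lemma graded_ab_subst_Y1:
  fixes g :: "'k::comm_ring_1 fps"
  shows "graded_ab (nc_subst g (Y 1)) = graded_subst g (- x1)"
proof (rule fps_ext)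
  fix n
  let ?r = "replicate n (YLetter 0)"
  have "fps_nth (graded_ab (nc_subst g (Y 1))) n =
      (\<Sum>w\<in>{?r}. fps2_const (nc_coeff (nc_subst g (Y 1)) w) * word_value x0 (x0 + x1) w)"
    unfolding graded_ab_def fps_nth_Abs_fps
  proof (rule sum.mono_neutral_right)
    show "\<forall>w\<in>words_of_weight n - {?r}.
        fps2_const (nc_coeff (nc_subst g (Y 1)) w) * word_value x0 (x0 + x1) w = 0"
    proof
      fix w assume w: "w \<in> words_of_weight n - {?r}"
      have "w \<noteq> replicate (length w) (YLetter 0)"
        using w weight_replicate_Y1 [of "length w"] by (auto simp: words_of_weight_def)
      then show "fps2_const (nc_coeff (nc_subst g (Y 1)) w) * word_value x0 (x0 + x1) w = 0"
        unfolding nc_coeff_subst_Y1 by simp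
    qed
    show "{?r} \<subseteq> words_of_weight n"
      by (simp add: words_of_weight_def weight_replicate_Y1)
  qed simp
  also have "word_value x0 (x0 + x1) ?r = (- x1 :: 'k fps fps) ^ n"
    by (induction n) (simp_all add: letter_value_def)
  then have "(\<Sum>w\<in>{?r}. fps2_const (nc_coeff (nc_subst g (Y 1)) w) * word_value x0 (x0 + x1) w) =
      fps_nth (graded_subst g (- x1)) n"
    unfolding nc_coeff_subst_Y1 by (simp add: graded_subst_def)
  finally show "fps_nth (graded_ab (nc_subst g (Y 1))) n = fps_nth (graded_subst g (- x1)) n" .
qed

section \<open>The differential equation of a group-like series\<close>

lemma sum_count_list_mult:
  fixes g :: "'a \<Rightarrow> 'r::comm_ring_1"
  assumes "finite V" "set xs \<subseteq> V"
  shows "(\<Sum>v\<in>V. of_nat (count_list xs v) * g v) = sum_list (map g xs)"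
  using assms(2)
proof (induction xs)
  case (Cons x xs)
  have "(\<Sum>v\<in>V. of_nat (count_list (x # xs) v) * g v) =
      (\<Sum>v\<in>V. (if v = x then g x else 0) + of_nat (count_list xs v) * g v)"
    by (intro sum.cong) (auto simp: distrib_right)
  then show ?case
    using Cons assms(1) by (simp add: sum.distrib)
qed simp

text \<open>
  Multiplying the sum over words of weight \<open>m\<close> by the coefficient of \<open>Y\<^sub>n\<close> turns it, by the quasi-shuffle
  relation, into a sum over words of weight \<open>m + n\<close> and their contractions.
\<close>

lemma graded_ab_times_letter:
  fixes f :: "(yletter, 'k::comm_ring_1) ncps"
  assumes f: "coprod_Y f = f \<otimes>\<^bsub>nc\<^esub> f" and n: "n > 0"
  shows "fps2_const (nc_coeff f [YLetter (n - 1)]) * fps_nth (graded_ab f) m =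
    (\<Sum>w\<in>words_of_weight (m + n). fps2_const (nc_coeff f w) *
      sum_list (map (word_value x0 (x0 + x1)) (contractions n w)))"
proof -
  let ?v = "word_value x0 (x0 + x1) :: yletter list \<Rightarrow> 'k fps fps"
  have "fps2_const (nc_coeff f [YLetter (n - 1)]) * fps_nth (graded_ab f) m =
      (\<Sum>v\<in>words_of_weight m. fps2_const (nc_coeff f [YLetter (n - 1)] * nc_coeff f v) * ?v v)"
    by (simp add: graded_ab_def sum_distrib_left mult.assoc)
  also have "\<dots> = (\<Sum>v\<in>words_of_weight m. \<Sum>w\<in>words_of_weight (m + n).
      fps2_const (nc_coeff f w) * (of_nat (count_list (contractions n w) v) * ?v v))"
  proof (rule sum.cong [OF refl])
    fix v assume "v \<in> words_of_weight m"
    then have "weight v = m" by (simp add: words_of_weight_def)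
    then show "fps2_const (nc_coeff f [YLetter (n - 1)] * nc_coeff f v) * ?v v =
        (\<Sum>w\<in>words_of_weight (m + n).
          fps2_const (nc_coeff f w) * (of_nat (count_list (contractions n w) v) * ?v v))"
      unfolding group_like_Y_single [OF f n \<open>weight v = m\<close>]
      by (simp add: fps2_const_sum sum_distrib_right mult.assoc)
  qed
  also have "\<dots> = (\<Sum>w\<in>words_of_weight (m + n). fps2_const (nc_coeff f w) *
      (\<Sum>v\<in>words_of_weight m. of_nat (count_list (contractions n w) v) * ?v v))"
    by (subst sum.swap) (simp add: sum_distrib_left)
  also have "\<dots> = (\<Sum>w\<in>words_of_weight (m + n). fps2_const (nc_coeff f w) *
      sum_list (map ?v (contractions n w)))"
  proof (rule sum.cong [OF refl])
    fix w assume "w \<in> words_of_weight (m + n)"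
    then have "set (contractions n w) \<subseteq> words_of_weight m"
      using weight_contractions by (fastforce simp: words_of_weight_def)
    then show "fps2_const (nc_coeff f w) *
        (\<Sum>v\<in>words_of_weight m. of_nat (count_list (contractions n w) v) * ?v v) =
        fps2_const (nc_coeff f w) * sum_list (map ?v (contractions n w))"
      by (simp add: sum_count_list_mult)
  qed
  finally show ?thesis .
qed

text \<open>
  The derivative in \<open>t\<close> multiplies a word by its weight, and \<open>sum_contractions_value\<close> writes the
  weight as a sum over contractions, which \<open>graded_ab_times_letter\<close> turns back into products.
\<close>

lemma deriv_graded_ab_group_like:
  fixes f :: "(yletter, 'k::comm_ring_1) ncps"
  assumes f: "coprod_Y f = f \<otimes>\<^bsub>nc\<^esub> f"
  defines "L \<equiv> Abs_fps (\<lambda>i. nc_coeff f [YLetter i])"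
  shows "fps_deriv (graded_ab f) = (log_deriv_subst L x0 - log_deriv_subst L (x0 + x1)) * graded_ab f"
proof (rule fps_ext)
  fix n
  let ?z = "x0 + x1 :: 'k fps fps"
  let ?v = "word_value x0 ?z"
  let ?d = "\<lambda>i. x0 ^ Suc i - ?z ^ Suc i"
  have "fps_nth (fps_deriv (graded_ab f)) n =
      (\<Sum>w\<in>words_of_weight (Suc n). fps2_const (nc_coeff f w) * (of_nat (weight w) * ?v w))"
    by (simp add: graded_ab_def sum_distrib_left words_of_weight_def mult_ac del: of_nat_Suc)
  also have "\<dots> = (\<Sum>w\<in>words_of_weight (Suc n). fps2_const (nc_coeff f w) *
      (\<Sum>i<Suc n. ?d i * sum_list (map ?v (contractions (Suc i) w))))"
    by (intro sum.cong refl, subst sum_contractions_value) (simp_all add: words_of_weight_def)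
  also have "\<dots> = (\<Sum>i<Suc n. ?d i * (\<Sum>w\<in>words_of_weight (Suc n). fps2_const (nc_coeff f w) *
      sum_list (map ?v (contractions (Suc i) w))))"
    unfolding sum_distrib_left by (subst sum.swap) (simp add: mult_ac del: power_Suc)
  also have "\<dots> = (\<Sum>i<Suc n. ?d i * (fps2_const (nc_coeff f [YLetter i]) * fps_nth (graded_ab f) (n - i)))"
  proof (rule sum.cong [OF refl])
    fix i assume "i \<in> {..<Suc n}"
    then have "n - i + Suc i = Suc n" by simp
    then show "?d i * (\<Sum>w\<in>words_of_weight (Suc n). fps2_const (nc_coeff f w) *
        sum_list (map ?v (contractions (Suc i) w))) =
        ?d i * (fps2_const (nc_coeff f [YLetter i]) * fps_nth (graded_ab f) (n - i))"
      using graded_ab_times_letter [OF f, of "Suc i" "n - i"] by simp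
  qed
  also have "\<dots> = fps_nth ((log_deriv_subst L x0 - log_deriv_subst L ?z) * graded_ab f) n"
    unfolding fps_mult_nth lessThan_Suc_atMost atLeast0AtMost
    by (intro sum.cong refl) (simp add: log_deriv_subst_def L_def algebra_simps)
  finally show "fps_nth (fps_deriv (graded_ab f)) n =
      fps_nth ((log_deriv_subst L x0 - log_deriv_subst L ?z) * graded_ab f) n" .
qed

text \<open>
  In the form \<open>\<Theta>(f) \<Gamma>(z t) = \<Gamma>(x t)\<close> of the evaluation both sides have the logarithmic
  derivative of \<open>\<Gamma>(x t)\<close>.
\<close>

lemma graded_ab_group_like:
  fixes f :: "(yletter, 'k::field_char_0) ncps"
  assumes f: "coprod_Y f = f \<otimes>\<^bsub>nc\<^esub> f" "nc_coeff f [] = 1"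
    and \<Gamma>: "fps_deriv \<Gamma> = Abs_fps (\<lambda>i. nc_coeff f [YLetter i]) * \<Gamma>" "fps_nth \<Gamma> 0 = 1"
  shows "graded_ab f * graded_subst \<Gamma> (x0 + x1) = graded_subst \<Gamma> x0"
proof (rule fps_linear_ODE_unique)
  let ?L = "Abs_fps (\<lambda>i. nc_coeff f [YLetter i])"
  show "fps_deriv (graded_ab f * graded_subst \<Gamma> (x0 + x1)) =
      log_deriv_subst ?L x0 * (graded_ab f * graded_subst \<Gamma> (x0 + x1))"
    by (simp add: deriv_graded_ab_group_like [OF f(1)] deriv_graded_subst [OF \<Gamma>(1)] algebra_simps)
  show "fps_deriv (graded_subst \<Gamma> x0) = log_deriv_subst ?L x0 * graded_subst \<Gamma> x0"
    by (rule deriv_graded_subst [OF \<Gamma>(1)])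
  show "fps_nth (graded_ab f * graded_subst \<Gamma> (x0 + x1)) 0 = fps_nth (graded_subst \<Gamma> x0) 0"
    by (simp add: graded_ab_nth_0 f(2) graded_subst_def \<Gamma>(2))
qed

section \<open>The meta-abelian quotient\<close>

lemma xword_simps [simp]:
  "xword [] = []"
  "xword (a # v) = replicate (yindex a - 1) X\<^sub>0 @ X\<^sub>1 # xword v"
  by (simp_all add: xword_def)

lemma inj_xword: "inj xword"
proof (rule injI)
  have prefix: "m = n \<and> r = s" if "replicate m X\<^sub>0 @ X\<^sub>1 # r = replicate n X\<^sub>0 @ X\<^sub>1 # s" for m n r s
    using that
  proof (induction m arbitrary: n)
    case 0
    then show ?case by (cases n) auto
  next
    case (Suc m)
    then show ?case by (cases n) auto
  qed
  fix u v assume "xword u = xword v"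
  then show "u = v"
  proof (induction u arbitrary: v)
    case Nil
    then show ?case by (cases v) auto
  next
    case (Cons a u)
    then obtain b v' where v: "v = b # v'" by (cases v) auto
    have "yindex a - 1 = yindex b - 1 \<and> xword u = xword v'"
      using Cons.prems unfolding v xword_simps by (rule prefix)
    then show ?case using Cons.IH v by (cases a; cases b) auto
  qed
qed

lemma last_xword: "v \<noteq> [] \<Longrightarrow> xword v \<noteq> [] \<and> last (xword v) = X\<^sub>1"
proof (induction v)
  case (Cons a v)
  then show ?case by (cases "v = []") (auto simp: last_append)
qed simp

lemma ex_xword: "w = [] \<or> last w = X\<^sub>1 \<Longrightarrow> \<exists>v. w = xword v"
proof (induction w)
  case Nil
  then show ?case by (intro exI [of _ "[]"]) simp
next
  case (Cons b w)
  then obtain v where v: "w = xword v" by (auto split: if_splits)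
  show ?case
  proof (cases b)
    case X\<^sub>0
    with Cons.prems v obtain k v' where "v = YLetter k # v'"
      by (cases v) (auto intro: yindex.cases)
    then show ?thesis using X\<^sub>0 v by (intro exI [of _ "YLetter (Suc k) # v'"]) simp
  next
    case X\<^sub>1
    then show ?thesis using v by (intro exI [of _ "YLetter 0 # v"]) simp
  qed
qed

lemma count_list_xword:
  "count_list (xword v) X\<^sub>1 = length v" "count_list (xword v) X\<^sub>0 + length v = weight v"
proof -
  have replicate: "count_list (replicate n X\<^sub>0) X\<^sub>1 = 0" "count_list (replicate n X\<^sub>0) X\<^sub>0 = n" for n
    by (induction n) auto
  show "count_list (xword v) X\<^sub>1 = length v" "count_list (xword v) X\<^sub>0 + length v = weight v"
    using yindex_pos(1) by (induction v) (auto simp: replicate Suc_le_eq)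
qed

lemma fps2_nth_x0_power_mult:
  "fps_nth (fps_nth (x0 ^ k * f) j) i = (if i < k then 0 else fps_nth (fps_nth f j) (i - k))"
proof (induction k arbitrary: i)
  case (Suc k)
  then show ?case by (cases i) (auto simp: mult.assoc fps2_nth_times_x0_x1)
qed simp

lemma fps2_nth_word_value:
  "fps_nth (fps_nth (word_value x0 (x0 + x1) w) j) i =
    (if length w = j \<and> weight w = i + j then (- 1) ^ j else (0::'k::comm_ring_1))"
proof (induction w arbitrary: i j)
  case (Cons a w)
  obtain k where a: "a = YLetter k" by (cases a)
  have "word_value x0 (x0 + x1) (a # w) = - (x1 * (x0 ^ k * word_value x0 (x0 + x1) w) :: 'k fps fps)"
    by (simp add: a letter_value_def mult_ac)
  then have "fps_nth (fps_nth (word_value x0 (x0 + x1) (a # w)) j) i =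
      (if j = 0 \<or> i < k then 0 else
        - (if length w = j - 1 \<and> weight w = i - k + (j - 1) then (- 1) ^ (j - 1) else (0::'k)))"
    by (simp add: fps2_nth_times_x0_x1 fps2_nth_x0_power_mult Cons.IH del: word_value_simps)
  also have "\<dots> = (if length (a # w) = j \<and> weight (a # w) = i + j then (- 1) ^ j else 0)"
    using length_le_weight [of w] by (cases j) (auto simp: a)
  finally show ?case .
qed auto

text \<open>
  Only the empty word and the words ending in \<open>X\<^sub>1\<close> enter the meta-abelian quotient, and these are the
  words \<open>xword v\<close>. The sign \<open>(-1)\<^sup>j\<close> of \<open>\<pi>\<^sub>Y\<close> cancels that of the value of \<open>v\<close>.
\<close>

lemma meta_abelian_quotient_eq_collapse:
  fixes \<phi> :: "(xletter, 'k::comm_ring_1) ncps"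
  assumes "nc_coeff \<phi> [] = 1"
  shows "meta_abelian_quotient \<phi> = collapse (graded_ab (pi_Y \<phi>))"
proof (intro fps_ext)
  fix i j
  define h where "h = 1 + right_part X\<^sub>1 \<phi> * nc_var X\<^sub>1"
  let ?V = "{v \<in> words_of_weight (i + j). length v = j}"
  let ?T = "\<lambda>w. nc_coeff h w * (if i = count_list w X\<^sub>0 \<and> j = count_list w X\<^sub>1 then 1 else 0)"
  have h_xword: "nc_coeff h (xword v) = nc_coeff \<phi> (xword v)" for v
  proof (cases "v = []")
    case False
    from last_xword [OF this] show ?thesis
      by (simp add: h_def nc_coeff_times_var right_part_def) (metis append_butlast_last_id)
  qed (simp add: h_def nc_coeff_times_var assms)
  have support: "{w. ?T w \<noteq> 0} \<subseteq> xword ` ?V"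
  proof
    fix w assume w: "w \<in> {w. ?T w \<noteq> 0}"
    then have "nc_coeff h w \<noteq> 0" by auto
    then have "w = [] \<or> last w = X\<^sub>1"
      by (auto simp: h_def nc_coeff_times_var split: if_splits)
    then obtain v where v: "w = xword v" using ex_xword by blast
    have "count_list w X\<^sub>0 = i" "count_list w X\<^sub>1 = j" using w by (auto split: if_splits)
    then have "v \<in> ?V" using count_list_xword [of v] by (simp add: v words_of_weight_def)
    then show "w \<in> xword ` ?V" using v by blast
  qed
  have "fps_nth (fps_nth (meta_abelian_quotient \<phi>) j) i = Sum_any ?T"
    by (simp add: meta_abelian_quotient_def abelianize_def abelianize_word h_def)
  also have "\<dots> = sum ?T (xword ` ?V)"
    by (rule Sum_any.expand_superset [OF _ support]) simp
  also have "\<dots> = (\<Sum>v\<in>?V. ?T (xword v))"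
    by (rule sum.reindex_cong [OF inj_on_subset [OF inj_xword subset_UNIV] refl refl])
  also have "\<dots> = (\<Sum>v\<in>?V. nc_coeff \<phi> (xword v))"
  proof (rule sum.cong [OF refl])
    fix v assume v: "v \<in> ?V"
    then have "count_list (xword v) X\<^sub>0 = i" "count_list (xword v) X\<^sub>1 = j"
      using count_list_xword [of v] by (auto simp: words_of_weight_def)
    then show "?T (xword v) = nc_coeff \<phi> (xword v)"
      by (simp add: h_xword)
  qed
  also have "\<dots> = (\<Sum>v\<in>words_of_weight (i + j).
      nc_coeff (pi_Y \<phi>) v * fps_nth (fps_nth (word_value x0 (x0 + x1) v) j) i)"
  proof -
    have "nc_coeff (pi_Y \<phi>) v * fps_nth (fps_nth (word_value x0 (x0 + x1) v) j) i =
        (if length v = j then nc_coeff \<phi> (xword v) else 0)" if "v \<in> words_of_weight (i + j)" for v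
    proof -
      have "(- 1) ^ j * c * (- 1) ^ j = c" for c :: 'k
        by (simp add: mult.commute [of _ c] mult.assoc flip: power_mult_distrib)
      then show ?thesis
        using that by (auto simp: fps2_nth_word_value pi_Y_def words_of_weight_def)
    qed
    then show ?thesis
      by (simp add: sum.inter_filter)
  qed
  also have "\<dots> = fps_nth (fps_nth (collapse (graded_ab (pi_Y \<phi>))) j) i"
    by (simp add: collapse_def graded_ab_def fps_sum_nth)
  finally show "fps_nth (fps_nth (meta_abelian_quotient \<phi>) j) i =
      fps_nth (fps_nth (collapse (graded_ab (pi_Y \<phi>))) j) i" .
qed

section \<open>Gamma elements\<close>

lemma fps2_subst_nth:
  assumes "homogeneous 1 p"
  shows "fps_nth (fps_nth (fps2_subst g p) j) i =
    fps_nth g (i + j) * fps_nth (fps_nth (p ^ (i + j)) j) i"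
  by (simp add: collapse_def graded_subst_def flip: collapse_graded_subst [OF assms])

lemma fps2_subst_x0: "fps2_subst g x0 = fps_const g"
proof (intro fps_ext)
  fix i j
  have "x0 ^ n = (fps_const (fps_X ^ n) :: 'a fps fps)" for n
    by (simp add: x0_def fps_const_power)
  then show "fps_nth (fps_nth (fps2_subst g x0) j) i = fps_nth (fps_nth (fps_const g) j) i"
    by (simp add: fps2_subst_nth [OF homogeneous_vars(1)])
qed

lemma fps2_subst_x1: "fps_nth (fps2_subst g x1) j = fps_const (fps_nth g j)"
  unfolding fps_eq_iff fps2_subst_nth [OF homogeneous_vars(2)] by (simp add: x1_def)

lemma fps2_subst_x0_plus_x1:
  fixes g :: "'k::comm_ring_1 fps"
  shows "fps_nth (fps2_subst g (x0 + x1)) 0 = g" "fps_nth (fps2_subst g (x0 + x1)) 1 = fps_deriv g"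
proof -
  have p0: "fps_nth ((x0 + x1) ^ n :: 'k fps fps) 0 = fps_X ^ n" for n
    by (induction n) (simp_all add: x0_def x1_def)
  have p1: "fps_nth ((x0 + x1) ^ Suc n :: 'k fps fps) 1 = of_nat (Suc n) * fps_X ^ n" for n
  proof (induction n)
    case (Suc n)
    have "fps_nth ((x0 + x1) ^ Suc (Suc n) :: 'k fps fps) 1 =
        fps_nth (x0 + x1) 0 * fps_nth ((x0 + x1) ^ Suc n) 1 + fps_nth (x0 + x1) 1 * fps_nth ((x0 + x1) ^ Suc n) 0"
      unfolding power_Suc [of _ "Suc n"] by (rule fps_mult_nth_1)
    then show ?case
      unfolding Suc p0 by (simp add: x0_def x1_def algebra_simps)
  qed (simp add: x0_def x1_def)
  show "fps_nth (fps2_subst g (x0 + x1)) 0 = g"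
    by (rule fps_ext) (simp add: fps2_subst_nth [OF homogeneous_vars(3)] p0)
  have "fps_nth (of_nat m * f) i = of_nat m * fps_nth f i" for m i and f :: "'k fps"
    by (simp flip: fps_of_nat)
  then show "fps_nth (fps2_subst g (x0 + x1)) 1 = fps_deriv g"
    by (intro fps_ext)
       (simp add: fps2_subst_nth [OF homogeneous_vars(3)] p1 [unfolded One_nat_def] mult.commute
         del: of_nat_Suc power_Suc)
qed

lemma is_gamma_element_iff:
  fixes \<Gamma> :: "'k::field_char_0 fps"
  shows "is_gamma_element \<Gamma> B \<longleftrightarrow> fps_nth \<Gamma> 0 = 1 \<and> fps_nth \<Gamma> 1 = 0 \<and>
    B * fps2_subst \<Gamma> (x0 + x1) = fps2_subst \<Gamma> x0 * fps2_subst \<Gamma> x1"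
proof -
  have form: "\<Gamma> \<in> {1 + fps_X ^ 2 * g | g. True} \<longleftrightarrow> fps_nth \<Gamma> 0 = 1 \<and> fps_nth \<Gamma> 1 = 0"
  proof
    assume "fps_nth \<Gamma> 0 = 1 \<and> fps_nth \<Gamma> 1 = 0"
    then have "fps_nth \<Gamma> n = fps_nth (1 + fps_X ^ 2 * fps_shift 2 \<Gamma>) n" for n
      by (cases n rule: nat.exhaust [case_product nat.exhaust [of "n - 1"]])
         (auto simp: fps_X_power_mult_nth)
    then have "\<Gamma> = 1 + fps_X ^ 2 * fps_shift 2 \<Gamma>"
      by (intro fps_ext)
    then show "\<Gamma> \<in> {1 + fps_X ^ 2 * g | g. True}" by blast
  qed (auto simp: fps_X_power_mult_nth)
  have div: "B = A / G \<longleftrightarrow> B * G = A" if "fps_nth (fps_nth G 0) 0 = 1" for A G :: "'k fps fps"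
  proof -
    have "A / G * G = A" "G \<noteq> 0"
      using that by (auto intro!: fps2_divide_mult)
    then show ?thesis by (metis mult_right_cancel)
  qed
  show ?thesis
    unfolding is_gamma_element_def form
    using div [of "fps2_subst \<Gamma> (x0 + x1)"] by (auto simp: fps2_subst_x0_plus_x1)
qed

text \<open>
  The coefficients of \<open>x\<^sub>1\<^sup>0\<close> and \<open>x\<^sub>1\<^sup>1\<close> in \<open>B(x\<^sub>0,x\<^sub>1) \<Gamma>(x\<^sub>0 + x\<^sub>1) = \<Gamma>(x\<^sub>0) \<Gamma>(x\<^sub>1)\<close>, with
  \<open>\<Gamma>(x\<^sub>1) = 1 + O(x\<^sub>1\<^sup>2)\<close>, give \<open>B(x\<^sub>0,0) = 1\<close> and then the logarithmic derivative of \<open>\<Gamma>\<close>.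
\<close>

lemma gamma_element_deriv:
  assumes "is_gamma_element \<Gamma> B"
  shows "fps_deriv \<Gamma> = - fps_nth B 1 * \<Gamma>"
proof -
  have \<Gamma>: "fps_nth \<Gamma> 0 = 1" "fps_nth \<Gamma> 1 = 0"
    and B: "B * fps2_subst \<Gamma> (x0 + x1) = fps_const \<Gamma> * fps2_subst \<Gamma> x1"
    using assms by (simp_all add: is_gamma_element_iff fps2_subst_x0)
  have "fps_nth B 0 * \<Gamma> = \<Gamma>"
    using arg_cong [OF B, of "\<lambda>F. fps_nth F 0"] by (simp add: fps2_subst_x0_plus_x1 fps2_subst_x1 \<Gamma>)
  then have "fps_nth B 0 = 1"
    using \<Gamma>(1) by auto
  moreover have "fps_nth B 0 * fps_deriv \<Gamma> + fps_nth B 1 * \<Gamma> = 0"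
    using arg_cong [OF B, of "\<lambda>F. fps_nth F 1"]
    unfolding fps_mult_nth_1 fps2_subst_x0_plus_x1 fps2_subst_x1 \<Gamma> by simp
  ultimately show ?thesis
    by (simp add: eq_neg_iff_add_eq_0)
qed

lemma gamma_element_unique:
  assumes "is_gamma_element \<Gamma> B" "is_gamma_element \<Gamma>' B"
  shows "\<Gamma> = \<Gamma>'"
  using fps_linear_ODE_unique [OF gamma_element_deriv [OF assms(1)] gamma_element_deriv [OF assms(2)]] assms
  by (simp add: is_gamma_element_iff)

section \<open>The correction term\<close>

definition corr_log :: "(xletter, 'k::field_char_0) ncps \<Rightarrow> 'k fps" where
  "corr_log \<phi> = Abs_fps (\<lambda>n. if n = 0 then 0 else
     (-1) ^ n / of_nat n * nc_coeff \<phi> (replicate (n - 1) X\<^sub>0 @ [X\<^sub>1]))"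

text \<open>
  The logarithm of the correction term is \<open>corr_log \<phi>\<close> at \<open>Y\<^sub>1\<close>, and \<open>\<Gamma>\<close> is chosen so that
  \<open>\<Gamma>(-s) = exp (- corr_log \<phi> (s))\<close>. In this form the statement on the correction term is immediate, and
  the coefficients of \<open>\<Gamma>' / \<Gamma>\<close> have to be recognised (\<open>gamma_series_deriv\<close>).
\<close>

definition gamma_series :: "(xletter, 'k::field_char_0) ncps \<Rightarrow> 'k fps" where
  "gamma_series \<phi> = fps_exp 1 oo - (corr_log \<phi> oo - fps_X)"

lemma corr_log_nth_0 [simp]: "fps_nth (corr_log \<phi>) 0 = 0"
  by (simp add: corr_log_def)

lemma fps_exp_compose_uminus:
  fixes a :: "'k::field_char_0 fps"
  assumes "fps_nth a 0 = 0"
  shows "(fps_exp 1 oo a) * (fps_exp 1 oo - a) = 1"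
proof -
  have "- a = - fps_X oo a"
    by (simp add: fps_compose_uminus assms)
  then have "fps_exp 1 oo - a = (fps_exp 1 oo - fps_X) oo a"
    by (simp add: fps_compose_assoc assms)
  also have "fps_exp 1 oo - fps_X = fps_exp (- 1 :: 'k)"
    by (rule fps_ext) (simp add: fps_compose_uminus')
  finally have "(fps_exp 1 oo a) * (fps_exp 1 oo - a) = (fps_exp 1 * fps_exp (- 1)) oo a"
    by (simp add: fps_compose_mult_distrib assms)
  then show ?thesis
    by (simp flip: fps_exp_add_mult)
qed

lemma fps_compose_uminus_X_twice: "(g oo - fps_X) oo - fps_X = (g :: 'k::comm_ring_1 fps)"
  by (rule fps_ext) (simp add: fps_compose_uminus' flip: mult.assoc power_mult_distrib)

lemma gamma_series_uminus: "gamma_series \<phi> oo - fps_X = fps_exp 1 oo - corr_log \<phi>"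
proof -
  have "gamma_series \<phi> oo - fps_X = fps_exp 1 oo (- (corr_log \<phi> oo - fps_X) oo - fps_X)"
    unfolding gamma_series_def by (rule fps_compose_assoc [symmetric]) simp_all
  then show ?thesis
    by (simp add: fps_compose_uminus fps_compose_uminus_X_twice)
qed

lemma nc_coeff_Y1_Nil [simp]: "nc_coeff (Y 1) [] = 0"
  by (simp add: Y_def)

lemma corr_term_eq: "corr_term \<phi> = nc_subst (fps_exp 1 oo corr_log \<phi>) (Y 1)"
  unfolding corr_term_def corr_log_def [symmetric]
  by (rule nc_subst_compose) (simp_all del: One_nat_def)

lemma gamma_series_at_uminus_Y1: "nc_subst (gamma_series \<phi>) (- Y 1) = nc_subst (fps_exp 1 oo - corr_log \<phi>) (Y 1)"
proof -
  have "nc_subst (gamma_series \<phi>) (- Y 1) = nc_subst (gamma_series \<phi>) (nc_subst (- fps_X) (Y 1))"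
    by (simp add: nc_subst_uminus_X del: One_nat_def)
  also have "\<dots> = nc_subst (gamma_series \<phi> oo - fps_X) (Y 1)"
    by (rule nc_subst_compose) (simp_all del: One_nat_def)
  finally show ?thesis by (simp add: gamma_series_uminus del: One_nat_def)
qed

lemma corr_term_eq_inverse: "corr_term \<phi> = nc_inverse (nc_subst (gamma_series \<phi>) (- Y 1))"
proof (rule nc_inverse_eqI [symmetric])
  show "nc_subst (gamma_series \<phi>) (- Y 1) * corr_term \<phi> = 1"
    and "corr_term \<phi> * nc_subst (gamma_series \<phi>) (- Y 1) = 1"
    unfolding gamma_series_at_uminus_Y1 corr_term_eq
    using fps_exp_compose_uminus [OF corr_log_nth_0 [of \<phi>]]
    by (simp_all add: mult.commute [of "_ oo - _"] del: One_nat_def flip: nc_subst_mult)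
qed

lemma graded_ab_corr_term: "graded_ab (corr_term \<phi>) * graded_subst (gamma_series \<phi>) x1 = 1"
proof -
  have "gamma_series \<phi> = (fps_exp 1 oo - corr_log \<phi>) oo - fps_X"
    by (simp add: fps_compose_uminus_X_twice flip: gamma_series_uminus)
  then have "graded_subst (gamma_series \<phi>) x1 = graded_subst (fps_exp 1 oo - corr_log \<phi>) (- x1)"
    by (simp add: graded_subst_uminus)
  then show ?thesis
    by (simp add: corr_term_eq graded_ab_subst_Y1 fps_exp_compose_uminus del: One_nat_def
        flip: graded_subst_mult)
qed

text \<open>
  The correction term has no part linear in \<open>Y\<^sub>1\<close>, because the coefficient of \<open>X\<^sub>1\<close> vanishes; so it does
  not affect the coefficients at single letters.
\<close>

lemma series_reg_nth:
  assumes "nc_coeff \<phi> [] = 1" "nc_coeff \<phi> [X\<^sub>1] = 0"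
  shows "nc_coeff (series_reg \<phi>) [] = 1"
    and "nc_coeff (series_reg \<phi>) [YLetter i] = - nc_coeff \<phi> (replicate i X\<^sub>0 @ [X\<^sub>1])"
proof -
  have "fps_nth (fps_exp 1 oo corr_log \<phi>) 1 = 0"
    using assms(2) by (simp add: fps_compose_nth corr_log_def)
  then have "nc_coeff (corr_term \<phi>) [YLetter i] = 0"
    unfolding corr_term_eq nc_coeff_subst_Y1 by simp
  moreover have "nc_coeff (corr_term \<phi>) [] = 1"
    unfolding corr_term_eq nc_coeff_subst_Y1 by simp
  ultimately show "nc_coeff (series_reg \<phi>) [] = 1"
    and "nc_coeff (series_reg \<phi>) [YLetter i] = - nc_coeff \<phi> (replicate i X\<^sub>0 @ [X\<^sub>1])"
    using assms(1) by (simp_all add: series_reg_def nc_coeff_times pi_Y_def)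
qed

lemma gamma_series_deriv:
  assumes "nc_coeff \<phi> [] = 1" "nc_coeff \<phi> [X\<^sub>1] = 0"
  shows "fps_deriv (gamma_series \<phi>) =
    Abs_fps (\<lambda>i. nc_coeff (series_reg \<phi>) [YLetter i]) * gamma_series \<phi>"
proof -
  let ?a = "- (corr_log \<phi> oo - fps_X)"
  have "fps_deriv ?a = Abs_fps (\<lambda>i. nc_coeff (series_reg \<phi>) [YLetter i])"
    by (rule fps_ext)
       (simp add: series_reg_nth [OF assms] fps_compose_uminus' corr_log_def
         del: of_nat_Suc flip: mult.assoc power_mult_distrib)
  moreover have "fps_deriv (gamma_series \<phi>) = gamma_series \<phi> * fps_deriv ?a"
    unfolding gamma_series_def by (subst fps_compose_deriv) simp_all
  ultimately show ?thesis by (simp add: mult.commute)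
qed

theorem theorem0p5:
  fixes \<phi> :: "(xletter, 'k::field_char_0) ncps"
  assumes "group_like \<phi>"
    and "nc_coeff \<phi> [X\<^sub>0] = 0" and "nc_coeff \<phi> [X\<^sub>1] = 0"
    and "coprod_Y (series_reg \<phi>) = series_reg \<phi> \<otimes>\<^bsub>nc\<^esub> series_reg \<phi>"
  shows "gamma_factorisable (meta_abelian_quotient \<phi>) \<and>
    (\<forall>\<Gamma>. is_gamma_element \<Gamma> (meta_abelian_quotient \<phi>) \<longrightarrow>
      corr_term \<phi> = nc_inverse (nc_subst \<Gamma> (- Y 1)))"
proof -
  let ?\<Gamma> = "gamma_series \<phi>"
  have const: "nc_coeff \<phi> [] = 1"
    using assms(1) by (simp add: group_like_def)
  have \<Gamma>0: "fps_nth ?\<Gamma> 0 = 1"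
    by (simp add: gamma_series_def)
  moreover have "fps_nth ?\<Gamma> 1 = 0"
    using arg_cong [OF gamma_series_deriv [OF const assms(3)], of "\<lambda>f. fps_nth f 0"] assms(3)
    by (simp add: series_reg_nth [OF const])
  moreover have "meta_abelian_quotient \<phi> * fps2_subst ?\<Gamma> (x0 + x1) = fps2_subst ?\<Gamma> x0 * fps2_subst ?\<Gamma> x1"
  proof -
    have reg: "graded_ab (corr_term \<phi>) * graded_ab (pi_Y \<phi>) * graded_subst ?\<Gamma> (x0 + x1) = graded_subst ?\<Gamma> x0"
      using graded_ab_group_like [OF assms(4) series_reg_nth(1) [OF const assms(3)]
          gamma_series_deriv [OF const assms(3)] \<Gamma>0]
      by (simp add: series_reg_def graded_ab_mult)
    \<comment> \<open>The evaluated correction term is cancelled by inserting its inverse \<open>\<Gamma>(x\<^sub>1 t)\<close>.\<close>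
    have "graded_ab (pi_Y \<phi>) * graded_subst ?\<Gamma> (x0 + x1) =
        (graded_ab (corr_term \<phi>) * graded_subst ?\<Gamma> x1) * (graded_ab (pi_Y \<phi>) * graded_subst ?\<Gamma> (x0 + x1))"
      by (simp add: graded_ab_corr_term)
    also have "\<dots> = graded_subst ?\<Gamma> x0 * graded_subst ?\<Gamma> x1"
      unfolding reg [symmetric] by (simp add: mult_ac)
    finally have "collapse (graded_ab (pi_Y \<phi>) * graded_subst ?\<Gamma> (x0 + x1)) =
        collapse (graded_subst ?\<Gamma> x0 * graded_subst ?\<Gamma> x1)"
      by (rule arg_cong)
    then show ?thesis
      by (simp add: collapse_mult homogeneous_graded_ab homogeneous_graded_subst homogeneous_vars
          collapse_graded_subst meta_abelian_quotient_eq_collapse [OF const] del: One_nat_def)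
  qed
  ultimately have "is_gamma_element ?\<Gamma> (meta_abelian_quotient \<phi>)"
    by (simp add: is_gamma_element_iff)
  then show ?thesis
    unfolding gamma_factorisable_def using gamma_element_unique corr_term_eq_inverse by metis
qed

end
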